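(* Let $\mathbb{h}\in\{\mathbb{R},\mathbb{C},\mathbb{H},\mathbb{O}\}$ be a real Hurwitz algebra, and let $f(x,y)=\operatorname{Re}\operatorname{tr}\bar x^{t}y$ on $M_n(\mathbb{h})$, with $|x|^2=f(x,x)$ and $[x,y]=xy-yx$. Consider the inequalities $$(\ast)\qquad |[x,y]|^2\le 2\left(|x|^2|y|^2-f(x,y)^2\right)\le 2|x|^2|y|^2.$$ (1) If $\mathbb{h}$ is associative, $(\ast)$ holds for all $x,y\in\mathrm{Herm}(n,\mathbb{h})$. (2) If $\mathbb{h}=\mathbb{O}$ and $n=3$, $(\ast)$ holds for all $y\in\mathrm{Herm}(3,\mathbb{O})$ and all diagonal $x\in\mathrm{Herm}(3,\mathbb{O})$. In (3) and (4) below, either $\mathbb{h}$ is associative and $x,y\in\mathrm{Herm}(n,\mathbb{h})$, or $\mathbb{h}=\mathbb{O}$, $n=3$, $y\in\mathrm{Herm}(3,\mathbb{O})$, and $x\in\mathrm{Herm}(3,\mathbb{O})$ is diagonal. (3) The equality $|[x,y]|^2=2|x|^2|y|^2$ holds if and only if $x$ and $y$ are simultaneously equivalent via an automorphism of the Jordan algebra $(\mathrm{Herm}(n,\mathbb{h}),\star)$ to real multiples of $e_{11}-e_{nn}$ and $e_{1n}+e_{n1}$. (4) The equality $|[x,y]|^2=2(|x|^2|y|^2-f(x,y)^2)$ holds if and only if $x$ and $y$ are either linearly dependent over $\mathbb{h}$ or are simultaneously equivalent via an automorphism of the Jordan algebra $(\mathrm{Herm}(n,\mathbb{h}),\star)$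 to real multiples of $e_{11}-e_{nn}$ and $e_{1n}+e_{n1}$.
   Context: $\mathbb{H}$ and $\mathbb{O}$ are the real quaternions and octonions, with standard conjugation $x\mapsto\bar x$. $M_n(\mathbb{h})$ is the space of $n\times n$ matrices over $\mathbb{h}$; juxtaposition is the matrix product. $\operatorname{Re}\operatorname{tr}\bar x^ty=\tfrac12\operatorname{tr}(\bar x^ty+\bar y^tx)$ is the Frobenius inner product. $\mathrm{Herm}(n,\mathbb{h})=\{x\in M_n(\mathbb{h}):\bar x^t=x\}$ with product $x\star y=\tfrac12(xy+yx)$. $e_{ij}$ is the matrix with $1$ in the $(i,j)$ entry and $0$ elsewhere. Norms are those of $f$ on $M_n(\mathbb{h})$.
   Formalization: As printed, (3) fails for x=0, y=identity, and (4) fails for non-orthogonal pairs and for dependence over the quaternions. Here (3) also allows x=0 or y=0; in (4) y is replaced by y−cx for some real c, and for quaternions linear dependence is over the reals. *)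

theory Defs
  imports "HOL-Analysis.Analysis"
begin

section \<open>Real algebras with conjugation, not assumed associative\<close>

text \<open>The ring classes of the library all assume associativity, so they cannot host the octonions.
  The operation hRe is the real part, pinned down by \<open>x + hconj x = 2 Re x\<close>.\<close>

class conj_algebra = real_vector + times + one +
  fixes hconj :: "'a \<Rightarrow> 'a"
    and hRe :: "'a \<Rightarrow> real"
  assumes hmult_add_left: "(x + y) * z = x * z + y * z"
    and hmult_add_right: "x * (y + z) = x * y + x * z"
    and hmult_scaleR_left: "scaleR r x * y = scaleR r (x * y)"
    and hmult_scaleR_right: "x * scaleR r y = scaleR r (x * y)"
    and hmult_one_left: "1 * x = x"
    and hmult_one_right: "x * 1 = x"
    and hone_neq_zero: "1 \<noteq> 0"
    and hconj_add: "hconj (x + y) = hconj x + hconj y"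
    and hconj_scaleR: "hconj (scaleR r x) = scaleR r (hconj x)"
    and hconj_mult: "hconj (x * y) = hconj y * hconj x"
    and hconj_hconj: "hconj (hconj x) = x"
    and add_hconj: "x + hconj x = scaleR (2 * hRe x) 1"

instantiation real :: conj_algebra
begin
definition hconj_real :: "real \<Rightarrow> real" where "hconj_real x = x"
definition hRe_real :: "real \<Rightarrow> real" where "hRe_real x = x"
instance by standard (simp_all add: hconj_real_def hRe_real_def algebra_simps)
end

instantiation complex :: conj_algebra
begin
definition hconj_complex :: "complex \<Rightarrow> complex" where "hconj_complex = cnj"
definition hRe_complex :: "complex \<Rightarrow> real" where "hRe_complex = Re"
instance
  by standard (simp_all add: hconj_complex_def hRe_complex_def algebra_simps complex_eq_iff)
end

section \<open>Quaternions and octonions by Cayley--Dickson doubling\<close>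

datatype 'a cd = CD (cd1: 'a) (cd2: 'a)

instantiation cd :: (real_vector) real_vector
begin
definition zero_cd :: "'a cd" where "zero_cd = CD 0 0"
definition plus_cd :: "'a cd \<Rightarrow> 'a cd \<Rightarrow> 'a cd"
  where "x + y = CD (cd1 x + cd1 y) (cd2 x + cd2 y)"
definition uminus_cd :: "'a cd \<Rightarrow> 'a cd" where "- x = CD (- cd1 x) (- cd2 x)"
definition minus_cd :: "'a cd \<Rightarrow> 'a cd \<Rightarrow> 'a cd"
  where "x - y = CD (cd1 x - cd1 y) (cd2 x - cd2 y)"
definition scaleR_cd :: "real \<Rightarrow> 'a cd \<Rightarrow> 'a cd"
  where "scaleR r x = CD (scaleR r (cd1 x)) (scaleR r (cd2 x))"
instance
  by standard (simp_all add: zero_cd_def plus_cd_def uminus_cd_def minus_cd_def scaleR_cd_def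
      scaleR_add_right scaleR_add_left)
end

lemma hconj_zero: "hconj (0 :: 'a::conj_algebra) = 0"
  using hconj_scaleR[of 0 "0 :: 'a"] by simp

lemma hconj_minus: "hconj (- x) = - hconj (x :: 'a::conj_algebra)"
  using hconj_scaleR[of "-1" x] by simp

lemma hconj_diff: "hconj (x - y) = hconj x - hconj (y :: 'a::conj_algebra)"
  using hconj_add[of x "- y"] by (simp add: hconj_minus)

lemma hmult_zero_left: "0 * x = (0 :: 'a::conj_algebra)"
  using hmult_scaleR_left[of 0 0 x] by simp

lemma hmult_zero_right: "x * 0 = (0 :: 'a::conj_algebra)"
  using hmult_scaleR_right[of x 0 0] by simp

lemma hmult_minus_left: "(- x) * y = - (x * y :: 'a::conj_algebra)"
  using hmult_scaleR_left[of "-1" x y] by simp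

lemma hmult_minus_right: "x * (- y) = - (x * y :: 'a::conj_algebra)"
  using hmult_scaleR_right[of x "-1" y] by simp

lemma hconj_one: "hconj (1 :: 'a::conj_algebra) = 1"
proof -
  have "hconj (1 :: 'a) = hconj 1 * hconj (hconj 1)"
    by (simp add: hconj_hconj hmult_one_right)
  also have "\<dots> = hconj (hconj 1 * 1)" by (simp add: hconj_mult)
  finally show ?thesis by (simp add: hmult_one_right hconj_hconj)
qed

instantiation cd :: (conj_algebra) conj_algebra
begin
definition one_cd :: "'a cd" where "one_cd = CD 1 0"
definition times_cd :: "'a cd \<Rightarrow> 'a cd \<Rightarrow> 'a cd"
  where "x * y = CD (cd1 x * cd1 y - hconj (cd2 y) * cd2 x) (cd2 y * cd1 x + cd2 x * hconj (cd1 y))"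
definition hconj_cd :: "'a cd \<Rightarrow> 'a cd" where "hconj x = CD (hconj (cd1 x)) (- cd2 x)"
definition hRe_cd :: "'a cd \<Rightarrow> real" where "hRe x = hRe (cd1 x)"
instance
  by standard (simp_all add: zero_cd_def plus_cd_def scaleR_cd_def one_cd_def times_cd_def
      hconj_cd_def hRe_cd_def hmult_add_left hmult_add_right hmult_scaleR_left hmult_scaleR_right
      hmult_one_left hmult_one_right hone_neq_zero hconj_add hconj_scaleR hconj_mult hconj_hconj
      add_hconj hconj_zero hconj_minus hconj_diff hmult_zero_left hmult_zero_right
      hmult_minus_left hmult_minus_right hconj_one scaleR_add_right scaleR_diff_right)
end

type_synonym quaternion = "complex cd"
type_synonym octonion = "quaternion cd"

lemma quaternion_mult_assoc: "(x * y) * z = x * (y * z)" for x y z :: quaternion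
  by (simp add: times_cd_def hconj_complex_def algebra_simps)

section \<open>Matrices\<close>

type_synonym ('h, 'n) sqmat = "(('h, 'n) vec, 'n) vec"

definition mmul :: "('h::conj_algebra, 'n::finite) sqmat \<Rightarrow> ('h, 'n) sqmat \<Rightarrow> ('h, 'n) sqmat" where
  "mmul x y = (\<chi> i j. \<Sum>k\<in>UNIV. x $ i $ k * y $ k $ j)"

definition conj_transpose :: "('h::conj_algebra, 'n::finite) sqmat \<Rightarrow> ('h, 'n) sqmat" where
  "conj_transpose x = (\<chi> i j. hconj (x $ j $ i))"

definition mtrace :: "('h::conj_algebra, 'n::finite) sqmat \<Rightarrow> 'h" where
  "mtrace x = (\<Sum>i\<in>UNIV. x $ i $ i)"

definition frob :: "('h::conj_algebra, 'n::finite) sqmat \<Rightarrow> ('h, 'n) sqmat \<Rightarrow> real" where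
  "frob x y = hRe (mtrace (mmul (conj_transpose x) y))"

definition norm_sq :: "('h::conj_algebra, 'n::finite) sqmat \<Rightarrow> real" where
  "norm_sq x = frob x x"

definition comm :: "('h::conj_algebra, 'n::finite) sqmat \<Rightarrow> ('h, 'n) sqmat \<Rightarrow> ('h, 'n) sqmat" where
  "comm x y = mmul x y - mmul y x"

definition Herm :: "('h::conj_algebra, 'n::finite) sqmat set" where
  "Herm = {x. conj_transpose x = x}"

definition diagonal :: "('h::conj_algebra, 'n::finite) sqmat \<Rightarrow> bool" where
  "diagonal x \<longleftrightarrow> (\<forall>i j. i \<noteq> j \<longrightarrow> x $ i $ j = 0)"

definition mat_unit :: "'n \<Rightarrow> 'n \<Rightarrow> ('h::conj_algebra, 'n::finite) sqmat" where
  "mat_unit i j = (\<chi> k l. if k = i \<and> l = j then 1 else 0)"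

text \<open>The linear order on the index type serves only to single out the indices \<open>1\<close> and \<open>n\<close>.\<close>

definition first_ix :: "'n::{finite,linorder}" where "first_ix = Min UNIV"

definition last_ix :: "'n::{finite,linorder}" where "last_ix = Max UNIV"

definition jmul :: "('h::conj_algebra, 'n::finite) sqmat \<Rightarrow> ('h, 'n) sqmat \<Rightarrow> ('h, 'n) sqmat" where
  "jmul x y = scaleR (1/2) (mmul x y + mmul y x)"

text \<open>Automorphisms are considered on \<open>Herm\<close> only; the values elsewhere are irrelevant.\<close>

definition jordan_aut :: "(('h::conj_algebra, 'n::finite) sqmat \<Rightarrow> ('h, 'n) sqmat) \<Rightarrow> bool" where
  "jordan_aut \<phi> \<longleftrightarrow> bij_betw \<phi> Herm Herm \<and>
     (\<forall>x\<in>Herm. \<forall>y\<in>Herm. \<phi> (x + y) = \<phi> x + \<phi> y) \<and>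
     (\<forall>r. \<forall>x\<in>Herm. \<phi> (scaleR r x) = scaleR r (\<phi> x)) \<and>
     (\<forall>x\<in>Herm. \<forall>y\<in>Herm. \<phi> (jmul x y) = jmul (\<phi> x) (\<phi> y))"

text \<open>A pair with \<open>sim_equiv x y\<close> is orthogonal for \<open>frob\<close>, whereas \<open>inner_eq x y\<close> is invariant
  under \<open>y \<mapsto> y - c x\<close>, \<open>c\<close> real. The equality case of the sharper inequality is therefore described
  by \<open>sim_equiv x (y - c x)\<close> for some \<open>c\<close>: for \<open>x = diag(1, -1)\<close> and \<open>y = ((1, 1), (1, -1))\<close>, which are
  independent and not orthogonal, \<open>inner_eq x y\<close> holds as \<open>8 = 2 (2 * 4 - 4)\<close>.\<close>

definition sim_equiv ::
    "('h::conj_algebra, 'n::{finite,linorder}) sqmat \<Rightarrow> ('h, 'n) sqmat \<Rightarrow> bool" where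
  "sim_equiv x y \<longleftrightarrow> (\<exists>\<phi> a b. jordan_aut \<phi> \<and>
     \<phi> x = scaleR a (mat_unit first_ix first_ix - mat_unit last_ix last_ix) \<and>
     \<phi> y = scaleR b (mat_unit first_ix last_ix + mat_unit last_ix first_ix))"

text \<open>Dependence with coefficients in the algebra, acting from the left. For Hermitian \<open>x\<close> and \<open>y\<close>
  this agrees with dependence from the right: \<open>a x + b y = 0\<close> iff \<open>x (hconj a) + y (hconj b) = 0\<close>.\<close>

definition lin_dep :: "('h::conj_algebra, 'n::finite) sqmat \<Rightarrow> ('h, 'n) sqmat \<Rightarrow> bool" where
  "lin_dep x y \<longleftrightarrow> (\<exists>a b :: 'h. (a \<noteq> 0 \<or> b \<noteq> 0) \<and> (\<forall>i j. a * x $ i $ j + b * y $ i $ j = 0))"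

text \<open>For Hermitian quaternionic matrices dependence over the quaternions is strictly weaker than
  dependence over the reals, because a left multiple by an imaginary quaternion can again be
  Hermitian. For \<open>x = diag(j J, j J)\<close> with \<open>J = ((0, 1), (-1, 0))\<close> and \<open>y = i x\<close> one has
  \<open>norm_sq (comm x y) = 16\<close>, \<open>norm_sq x = norm_sq y = 4\<close> and \<open>frob x y = 0\<close>, so it does not
  imply \<open>inner_eq\<close>, and real coefficients have to be used there.\<close>

definition lin_dep_real :: "('h::conj_algebra, 'n::finite) sqmat \<Rightarrow> ('h, 'n) sqmat \<Rightarrow> bool" where
  "lin_dep_real x y \<longleftrightarrow> (\<exists>a b :: real. (a \<noteq> 0 \<or> b \<noteq> 0) \<and> scaleR a x + scaleR b y = 0)"

definition ineq_star :: "('h::conj_algebra, 'n::finite) sqmat \<Rightarrow> ('h, 'n) sqmat \<Rightarrow> bool" where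
  "ineq_star x y \<longleftrightarrow>
     norm_sq (comm x y) \<le> 2 * (norm_sq x * norm_sq y - (frob x y)\<^sup>2) \<and>
     2 * (norm_sq x * norm_sq y - (frob x y)\<^sup>2) \<le> 2 * norm_sq x * norm_sq y"

definition outer_eq :: "('h::conj_algebra, 'n::finite) sqmat \<Rightarrow> ('h, 'n) sqmat \<Rightarrow> bool" where
  "outer_eq x y \<longleftrightarrow> norm_sq (comm x y) = 2 * norm_sq x * norm_sq y"

definition inner_eq :: "('h::conj_algebra, 'n::finite) sqmat \<Rightarrow> ('h, 'n) sqmat \<Rightarrow> bool" where
  "inner_eq x y \<longleftrightarrow> norm_sq (comm x y) = 2 * (norm_sq x * norm_sq y - (frob x y)\<^sup>2)"

end

theory Submission
  imports Defs
begin

text \<open>Everything rests on the case of a real diagonal matrix \<open>x\<close> with diagonal \<open>d\<close>. There the entries of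
  the commutator are \<open>(d i - d j) y i j\<close>, so the difference of the two sides of
  \<open>|[x,y]|\<^sup>2 \<le> 2 |x|\<^sup>2 |y|\<^sup>2\<close> is the sum of \<open>(2 |x|\<^sup>2 - (d i - d j)\<^sup>2) |y i j|\<^sup>2\<close>, and each coefficient is
  nonnegative by the parallelogram law (\<open>norm_sq_comm_le_diagonal\<close>). Only real numbers multiply the
  entries of \<open>y\<close>, so this covers the octonions. In the case of equality a nonzero entry
  of \<open>y\<close> at \<open>(i, j)\<close> forces \<open>i \<noteq> j\<close>,
  \<open>d j = - d i\<close> and all other diagonal entries of \<open>x\<close> to vanish, so \<open>x\<close> is a multiple of \<open>e\<^sub>i\<^sub>i - e\<^sub>j\<^sub>j\<close>
  and \<open>y\<close> lives at \<open>(i, j)\<close> and \<open>(j, i)\<close> only (\<open>outer_eq_diagonal_shape\<close>). A permutation of the indices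
  and an automorphism that makes the remaining entry of \<open>y\<close> real bring the pair to standard form. Over an
  associative algebra the second automorphism is conjugation by a diagonal unitary matrix. For size three over
  the octonions it is a triality map whose multiplicativity is the Moufang identities
  (\<open>jordan_aut_rotating_entry_to_real\<close>).

  The converse has to cope with an arbitrary Jordan automorphism. If it takes \<open>(x, y)\<close> to the
  standard pair with factors \<open>a\<close> and \<open>b\<close>, both nonzero, then \<open>x\<^sup>2 = a\<^sup>2 p\<close>, \<open>y\<^sup>2 = b\<^sup>2 p\<close> and \<open>x \<star> y = 0\<close>
  for an idempotent \<open>p\<close> that is the image of \<open>e\<^sub>1\<^sub>1 + e\<^sub>n\<^sub>n\<close> under the inverse. For diagonal \<open>x\<close> these
  relations determine all three norms in terms of \<open>a\<close>, \<open>b\<close> and the trace of \<open>p\<close>. That trace is \<open>2\<close> because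
  automorphisms preserve primitive idempotents and these have trace \<open>1\<close>
  (\<open>trace_primitive_idempotent\<close>).

  Over an associative algebra a general Hermitian \<open>x\<close> is reduced to a diagonal one by unitary
  conjugation, which is a Jordan automorphism and preserves norms and commutators. The diagonalisation
  (\<open>unitary_diagonalisation\<close>) is Jacobi's: a unitary matrix that maximises the sum of squares of the
  diagonal entries exists by compactness, and a nonzero off-diagonal entry would let a plane rotation increase
  that sum.

  The sharper inequality and its equality case follow from the weaker one applied to the component of \<open>y\<close>
  orthogonal to \<open>x\<close>, since adding multiples of \<open>x\<close> to \<open>y\<close> changes neither the commutator nor the
  Gram determinant (\<open>sharp_inequality\<close>).\<close>

section \<open>Cayley--Dickson doubles as Euclidean spaces\<close>

instantiation cd :: (real_inner) real_inner
begin
definition inner_cd :: "'a cd \<Rightarrow> 'a cd \<Rightarrow> real"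
  where "inner_cd x y = inner (cd1 x) (cd1 y) + inner (cd2 x) (cd2 y)"
definition norm_cd :: "'a cd \<Rightarrow> real" where "norm_cd x = sqrt (inner x x)"
definition dist_cd :: "'a cd \<Rightarrow> 'a cd \<Rightarrow> real" where "dist_cd x y = norm (x - y)"
definition sgn_cd :: "'a cd \<Rightarrow> 'a cd" where "sgn_cd x = x /\<^sub>R norm x"
definition uniformity_cd :: "('a cd \<times> 'a cd) filter"
  where [code del]: "uniformity_cd = (INF e\<in>{0 <..}. principal {(x, y). dist x y < e})"
definition open_cd :: "'a cd set \<Rightarrow> bool"
  where [code del]: "open_cd U = (\<forall>x\<in>U. \<forall>\<^sub>F (x', y) in uniformity. x' = x \<longrightarrow> y \<in> U)"
instance
proof
  fix x y z :: "'a cd" and r :: real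
  show "inner x y = inner y x" by (simp add: inner_cd_def inner_commute)
  show "inner (x + y) z = inner x z + inner y z"
    by (simp add: inner_cd_def plus_cd_def inner_left_distrib)
  show "inner (r *\<^sub>R x) y = r * inner x y"
    by (simp add: inner_cd_def scaleR_cd_def distrib_left)
  show "0 \<le> inner x x" by (simp add: inner_cd_def)
  show "inner x x = 0 \<longleftrightarrow> x = 0"
    by (cases x) (simp add: inner_cd_def zero_cd_def add_nonneg_eq_0_iff)
qed (simp_all add: norm_cd_def dist_cd_def sgn_cd_def uniformity_cd_def open_cd_def)
end

instantiation cd :: (euclidean_space) euclidean_space
begin
definition Basis_cd :: "'a cd set" where "Basis_cd = (\<lambda>u. CD u 0) ` Basis \<union> CD 0 ` Basis"
instance
proof
  show "(Basis :: 'a cd set) \<noteq> {}" by (simp add: Basis_cd_def)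
  show "finite (Basis :: 'a cd set)" by (simp add: Basis_cd_def)
  show "inner u v = (if u = v then 1 else 0)" if "u \<in> Basis" "v \<in> Basis" for u v :: "'a cd"
    using that by (auto simp: Basis_cd_def inner_cd_def inner_Basis split: if_splits)
  show "(\<forall>u\<in>Basis. inner x u = 0) \<longleftrightarrow> x = 0" for x :: "'a cd"
    by (cases x) (simp add: Basis_cd_def inner_cd_def zero_cd_def ball_Un euclidean_all_zero_iff)
qed
end

section \<open>Hurwitz algebras\<close>

text \<open>The second axiom is the part of alternativity from which the rest follows. It makes the norm
  anisotropic and the left multiplications invertible. The Euclidean structure of the class supplies the
  topology for the compactness of the unitary group.\<close>

class hurwitz_algebra = conj_algebra + euclidean_space +
  assumes inner_eq_hRe: "inner x y = hRe (hconj x * y)"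
    and hconj_mult_cancel: "hconj x * (x * y) = scaleR ((norm x)\<^sup>2) y"

class assoc_hurwitz = hurwitz_algebra +
  assumes hmult_assoc: "(x * y) * z = x * (y * z)"

class comm_hurwitz = assoc_hurwitz +
  assumes hmult_commute: "x * y = y * x"

instance real :: comm_hurwitz
proof
  fix x y z :: real
  show "inner x y = hRe (hconj x * y)" by (simp add: hconj_real_def hRe_real_def)
  show "hconj x * (x * y) = scaleR ((norm x)\<^sup>2) y"
    by (simp add: hconj_real_def power2_eq_square)
qed (fact mult.assoc mult.commute)+

instance complex :: comm_hurwitz
proof
  fix x y z :: complex
  show "inner x y = hRe (hconj x * y)"
    by (simp add: hconj_complex_def hRe_complex_def inner_complex_def)
  have "cnj x * x = of_real ((norm x)\<^sup>2)" by (metis complex_norm_square mult.commute)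
  then show "hconj x * (x * y) = scaleR ((norm x)\<^sup>2) y"
    by (simp add: hconj_complex_def scaleR_conv_of_real flip: mult.assoc)
qed (fact mult.assoc mult.commute)+

lemma hRe_one: "hRe (1 :: 'h::conj_algebra) = 1"
proof -
  have "scaleR 2 (1::'h) = scaleR (2 * hRe (1::'h)) 1"
    using add_hconj[of "1::'h"] by (simp add: hconj_one scaleR_2)
  then show ?thesis by (simp add: hone_neq_zero)
qed

lemma hRe_hconj: "hRe (hconj x) = hRe (x :: 'h::conj_algebra)"
proof -
  have "scaleR (2 * hRe (hconj x)) (1::'h) = scaleR (2 * hRe x) 1"
    unfolding add_hconj[symmetric] by (simp add: hconj_hconj add.commute)
  then show ?thesis by (simp add: hone_neq_zero)
qed

lemma hconj_eq: "hconj x = scaleR (2 * hRe x) 1 - (x :: 'h::conj_algebra)"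
  unfolding add_hconj[symmetric] by simp

lemma hRe_eq_inner: "hRe x = inner 1 (x :: 'h::hurwitz_algebra)"
  by (simp add: inner_eq_hRe hconj_one hmult_one_left)

lemma hRe_add: "hRe (x + y) = hRe x + hRe (y :: 'h::hurwitz_algebra)"
  by (simp add: hRe_eq_inner inner_right_distrib)

lemma hRe_diff: "hRe (x - y) = hRe x - hRe (y :: 'h::hurwitz_algebra)"
  by (simp add: hRe_eq_inner inner_diff_right)

lemma hRe_minus: "hRe (- x) = - hRe (x :: 'h::hurwitz_algebra)"
  by (simp add: hRe_eq_inner)

lemma hRe_scaleR: "hRe (scaleR r x) = r * hRe (x :: 'h::hurwitz_algebra)"
  by (simp add: hRe_eq_inner)

lemma norm_one_hurwitz: "norm (1 :: 'h::hurwitz_algebra) = 1"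
  by (simp add: norm_eq_sqrt_inner hRe_eq_inner[symmetric] hRe_one)

lemma hconj_mult_self: "hconj x * x = scaleR ((norm x)\<^sup>2) (1 :: 'h::hurwitz_algebra)"
  using hconj_mult_cancel[of x 1] by (simp add: hmult_one_right)

text \<open>Conjugation is the reflection that fixes the line spanned by the unit and negates its
  orthogonal complement.\<close>

lemma norm_hconj: "norm (hconj x) = norm (x :: 'h::hurwitz_algebra)"
proof -
  have "(norm (hconj x))\<^sup>2 = (norm x)\<^sup>2"
    unfolding hconj_eq power2_norm_eq_inner
    by (simp add: inner_diff_left inner_diff_right hRe_eq_inner[symmetric]
        inner_commute[of x 1] hRe_one algebra_simps)
  then show ?thesis by simp
qed

lemma mult_hconj_self: "x * hconj x = scaleR ((norm x)\<^sup>2) (1 :: 'h::hurwitz_algebra)"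
  using hconj_mult_self[of "hconj x"] by (simp add: hconj_hconj norm_hconj)

lemma mult_hconj_cancel_left: "x * (hconj x * y) = scaleR ((norm x)\<^sup>2) (y :: 'h::hurwitz_algebra)"
  using hconj_mult_cancel[of "hconj x" y] by (simp add: hconj_hconj norm_hconj)

lemma mult_hconj_cancel_right: "(y * x) * hconj x = scaleR ((norm x)\<^sup>2) (y :: 'h::hurwitz_algebra)"
  using mult_hconj_cancel_left[of x "hconj y"] 
  by (metis hconj_hconj hconj_mult hconj_scaleR)

lemma hconj_mult_cancel_right: "(y * hconj x) * x = scaleR ((norm x)\<^sup>2) (y :: 'h::hurwitz_algebra)"
  using mult_hconj_cancel_right[of y "hconj x"] by (simp add: hconj_hconj norm_hconj)

lemma inner_hconj: "inner (hconj x) (hconj y) = inner x (y :: 'h::hurwitz_algebra)"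
proof -
  have "(norm (hconj (x + y)))\<^sup>2 = (norm (x + y))\<^sup>2" by (simp add: norm_hconj)
  moreover have "inner (hconj z) (hconj z) = inner z z" for z :: 'h
    using norm_hconj[of z] by (metis power2_norm_eq_inner)
  ultimately show ?thesis
    by (simp add: power2_norm_eq_inner hconj_add inner_add_left inner_add_right inner_commute)
qed

lemma hRe_mult_commute: "hRe (x * y) = hRe (y * x :: 'h::hurwitz_algebra)"
proof -
  have "hRe (x * y) = hRe (hconj (hconj x) * y)" by (simp add: hconj_hconj)
  also have "\<dots> = inner (hconj (hconj x)) (hconj y)"
    by (simp only: inner_eq_hRe[symmetric] inner_hconj)
  also have "\<dots> = hRe (hconj (y * x))"
    by (simp add: inner_eq_hRe hconj_hconj hconj_mult)
  finally show ?thesis by (simp add: hRe_hconj)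
qed

lemma mult_eq_0_hurwitz: "x * y = 0 \<longleftrightarrow> x = 0 \<or> y = (0 :: 'h::hurwitz_algebra)"
proof
  assume "x * y = 0"
  then show "x = 0 \<or> y = 0"
    using hconj_mult_cancel[of x y] by (simp add: hmult_zero_right)
qed (auto simp: hmult_zero_right hmult_zero_left)

lemma mult_hconj_plus: "x * hconj y + y * hconj x = scaleR (2 * inner x y) (1 :: 'h::hurwitz_algebra)"
proof -
  have "hRe (x * hconj y) = inner x y"
    using inner_hconj[of x y] unfolding inner_eq_hRe hconj_hconj by simp
  moreover have "hconj (x * hconj y) = y * hconj x" by (simp add: hconj_mult hconj_hconj)
  ultimately show ?thesis using add_hconj[of "x * hconj y"] by simp
qed

text \<open>This is why diagonal entries of Hermitian matrices are real.\<close>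

lemma hconj_fixed: "hconj x = x \<Longrightarrow> x = scaleR (hRe x) (1 :: 'h::hurwitz_algebra)"
proof -
  assume "hconj x = x"
  then have "scaleR 2 x = scaleR 2 (scaleR (hRe x) 1)"
    using add_hconj[of x] by (simp add: scaleR_2[of x, symmetric])
  then show ?thesis by (simp del: scaleR_scaleR)
qed

interpretation hmult: bounded_bilinear "(*) :: 'h::hurwitz_algebra \<Rightarrow> 'h \<Rightarrow> 'h"
  by (simp add: bilinear_conv_bounded_bilinear[symmetric] bilinear_def linear_iff
      hmult_add_left hmult_add_right hmult_scaleR_left hmult_scaleR_right)

lemma linear_hconj: "linear (hconj :: 'h::hurwitz_algebra \<Rightarrow> 'h)"
  by (simp add: linear_iff hconj_add hconj_scaleR)

lemma linear_hRe: "linear (hRe :: 'h::hurwitz_algebra \<Rightarrow> real)"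
  by (simp add: linear_iff hRe_add hRe_scaleR)

lemmas hconj_sum = linear_sum[OF linear_hconj]
lemmas hRe_sum = linear_sum[OF linear_hRe]

text \<open>Doubling weakens the multiplication by one step: the double of a commutative associative
  algebra is associative, the double of an associative one is still alternative. Starting from the
  complex numbers this reaches the quaternions and the octonions.\<close>

instance cd :: (assoc_hurwitz) hurwitz_algebra
proof
  fix x y :: "'a cd"
  show "inner x y = hRe (hconj x * y)"
    by (simp add: inner_cd_def hRe_cd_def hconj_cd_def times_cd_def hRe_add hRe_diff
        inner_eq_hRe[symmetric] hmult_minus_right hRe_minus inner_commute[of "cd2 x"])
  obtain p q r s where x: "x = CD p q" and y: "y = CD r s" by (cases x, cases y) auto
  have "(norm x)\<^sup>2 = (norm p)\<^sup>2 + (norm q)\<^sup>2"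
    by (simp add: power2_norm_eq_inner x inner_cd_def)
  moreover have "hconj q * (q * z) = scaleR ((norm q)\<^sup>2) z" "z * (p * hconj p) = scaleR ((norm p)\<^sup>2) z"
    "z * (hconj q * q) = scaleR ((norm q)\<^sup>2) z" "q * (hconj q * z) = scaleR ((norm q)\<^sup>2) z" for z
    by (simp_all add: hconj_mult_cancel mult_hconj_self hmult_scaleR_right hmult_one_right 
        hconj_mult_self mult_hconj_cancel_left)
  ultimately show "hconj x * (x * y) = scaleR ((norm x)\<^sup>2) y"
    by (simp add: x y times_cd_def hconj_cd_def scaleR_cd_def hconj_mult hconj_hconj hconj_add hconj_diff
      hmult_assoc hmult_minus_left hmult_minus_right hmult_add_left hmult_add_right hmult.diff_left hmult.diff_right 
      hconj_mult_cancel scaleR_add_left)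
qed

instance cd :: (comm_hurwitz) assoc_hurwitz
proof
  fix x y z :: "'a cd"
  have lc: "a * (b * c) = b * (a * c)" for a b c :: 'a
    by (metis hmult_assoc hmult_commute)
  show "(x * y) * z = x * (y * z)"
    by (simp add: times_cd_def hconj_mult hconj_hconj hconj_add hconj_diff
      hmult_assoc hmult_add_left hmult_add_right hmult.diff_left hmult.diff_right
      hmult_commute lc)
qed

section \<open>Hermitian matrices and Jordan automorphisms\<close>

lemma frob_eq_inner: "frob x y = inner x (y :: ('h::hurwitz_algebra, 'n::finite) sqmat)"
proof -
  have "frob x y = (\<Sum>i\<in>UNIV. \<Sum>k\<in>UNIV. inner (x $ k $ i) (y $ k $ i))"
    by (simp add: frob_def mtrace_def mmul_def conj_transpose_def hRe_sum inner_eq_hRe)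
  also have "\<dots> = inner x y" by (subst sum.swap) (simp add: inner_vec_def)
  finally show ?thesis .
qed

lemma norm_sq_eq_norm: "norm_sq x = (norm (x :: ('h::hurwitz_algebra, 'n::finite) sqmat))\<^sup>2"
  by (simp add: norm_sq_def frob_eq_inner power2_norm_eq_inner)

lemma norm_sq_eq_sum:
  "norm_sq x = (\<Sum>i\<in>UNIV. \<Sum>j\<in>UNIV. (norm (x $ i $ j :: 'h::hurwitz_algebra))\<^sup>2)"
  by (simp add: norm_sq_def frob_eq_inner inner_vec_def power2_norm_eq_inner)

interpretation mmul: bounded_bilinear
  "mmul :: ('h::hurwitz_algebra, 'n::finite) sqmat \<Rightarrow> ('h, 'n) sqmat \<Rightarrow> ('h, 'n) sqmat"
  by (simp add: bilinear_conv_bounded_bilinear[symmetric] bilinear_def linear_iff vec_eq_iff mmul_def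
      hmult_add_left hmult_add_right hmult_scaleR_left hmult_scaleR_right sum.distrib scaleR_sum_right)

lemma linear_conj_transpose:
  "linear (conj_transpose :: ('h::hurwitz_algebra, 'n::finite) sqmat \<Rightarrow> _)"
  by (simp add: linear_iff vec_eq_iff conj_transpose_def hconj_add hconj_scaleR)

lemma conj_transpose_conj_transpose [simp]: "conj_transpose (conj_transpose x) = x"
  by (simp add: conj_transpose_def vec_eq_iff hconj_hconj)

lemma conj_transpose_mmul:
  "conj_transpose (mmul x y) = mmul (conj_transpose y) (conj_transpose (x :: ('h::hurwitz_algebra, 'n::finite) sqmat))"
  by (simp add: conj_transpose_def mmul_def vec_eq_iff hconj_sum hconj_mult)

lemma Herm_iff: "x \<in> Herm \<longleftrightarrow> (\<forall>i j. hconj (x $ j $ i) = x $ i $ j)"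
  by (simp add: Herm_def conj_transpose_def vec_eq_iff)

lemma HermD: "x \<in> Herm \<Longrightarrow> hconj (x $ j $ i) = x $ i $ j"
  by (simp add: Herm_iff)

lemma Herm_diagonal_entry:
  "x \<in> Herm \<Longrightarrow> x $ i $ i = scaleR (hRe (x $ i $ i)) (1 :: 'h::hurwitz_algebra)"
  by (simp add: hconj_fixed HermD)

lemma Herm_norm_sym: "x \<in> Herm \<Longrightarrow> norm (x $ j $ i) = norm (x $ i $ j :: 'h::hurwitz_algebra)"
  by (metis HermD norm_hconj)

lemma Herm_add: "x \<in> Herm \<Longrightarrow> y \<in> Herm \<Longrightarrow> x + y \<in> (Herm :: ('h::hurwitz_algebra, 'n::finite) sqmat set)"
  by (simp add: Herm_iff hconj_add)

lemma Herm_scaleR: "x \<in> Herm \<Longrightarrow> scaleR r x \<in> (Herm :: ('h::hurwitz_algebra, 'n::finite) sqmat set)"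
  by (simp add: Herm_iff hconj_scaleR)

lemma Herm_diff: "x \<in> Herm \<Longrightarrow> y \<in> Herm \<Longrightarrow> x - y \<in> (Herm :: ('h::hurwitz_algebra, 'n::finite) sqmat set)"
  by (simp add: Herm_iff hconj_diff)

lemma Herm_jmul: "x \<in> Herm \<Longrightarrow> y \<in> Herm \<Longrightarrow> jmul x y \<in> (Herm :: ('h::hurwitz_algebra, 'n::finite) sqmat set)"
  unfolding Herm_def jmul_def mem_Collect_eq
  by (simp add: linear_add[OF linear_conj_transpose] linear_scale[OF linear_conj_transpose]
      conj_transpose_mmul add.commute)

lemma conj_transpose_mat_unit: "conj_transpose (mat_unit i j) = mat_unit j i"
  by (auto simp: conj_transpose_def mat_unit_def vec_eq_iff hconj_one hconj_zero)

lemma Herm_mat_unit_diag: "mat_unit i i \<in> Herm"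
  by (simp add: Herm_def conj_transpose_mat_unit)

lemma jordan_aut_comp:
  fixes \<phi> \<psi> :: "('h::hurwitz_algebra, 'n::finite) sqmat \<Rightarrow> ('h, 'n) sqmat"
  assumes "jordan_aut \<phi>" "jordan_aut \<psi>"
  shows "jordan_aut (\<psi> \<circ> \<phi>)"
proof -
  have "\<phi> x \<in> Herm" if "x \<in> Herm" for x
    using assms(1) that by (auto simp: jordan_aut_def bij_betw_def)
  then show ?thesis
    using assms by (auto simp: jordan_aut_def intro: bij_betw_trans)
qed

lemma jordan_aut_inv:
  fixes \<phi> :: "('h::hurwitz_algebra, 'n::finite) sqmat \<Rightarrow> ('h, 'n) sqmat"
  assumes "jordan_aut \<phi>"
  shows "jordan_aut (inv_into Herm \<phi>)"
proof -
  have bij: "bij_betw \<phi> Herm Herm" using assms by (simp add: jordan_aut_def)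
  let ?\<psi> = "inv_into Herm \<phi>"
  have in_H: "?\<psi> x \<in> Herm" and r: "\<phi> (?\<psi> x) = x" if "x \<in> Herm" for x
    using bij that by (simp_all add: bij_betw_inv_into_right bij_betw_def inv_into_into)
  have l: "?\<psi> (\<phi> x) = x" if "x \<in> Herm" for x
    using bij that by (simp add: bij_betw_inv_into_left)
  have "?\<psi> (x + y) = ?\<psi> x + ?\<psi> y" if "x \<in> Herm" "y \<in> Herm" for x y
    using assms l[of "?\<psi> x + ?\<psi> y"] that by (simp add: jordan_aut_def in_H r Herm_add)
  moreover have "?\<psi> (scaleR c x) = scaleR c (?\<psi> x)" if "x \<in> Herm" for x c
    using assms l[of "scaleR c (?\<psi> x)"] that by (simp add: jordan_aut_def in_H r Herm_scaleR)
  moreover have "?\<psi> (jmul x y) = jmul (?\<psi> x) (?\<psi> y)" if "x \<in> Herm" "y \<in> Herm" for x y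
    using assms l[of "jmul (?\<psi> x) (?\<psi> y)"] that by (simp add: jordan_aut_def in_H r Herm_jmul)
  ultimately show ?thesis
    using bij by (simp add: jordan_aut_def bij_betw_inv_into)
qed

lemma jordan_autI:
  fixes \<phi> :: "('h::hurwitz_algebra, 'n::finite) sqmat \<Rightarrow> ('h, 'n) sqmat"
  assumes "\<And>x. x \<in> Herm \<Longrightarrow> \<phi> x \<in> Herm" "\<And>x. x \<in> Herm \<Longrightarrow> \<psi> x \<in> Herm"
    and "\<And>x. x \<in> Herm \<Longrightarrow> \<psi> (\<phi> x) = x" "\<And>x. x \<in> Herm \<Longrightarrow> \<phi> (\<psi> x) = x"
    and "linear \<phi>"
    and "\<And>x y. x \<in> Herm \<Longrightarrow> y \<in> Herm \<Longrightarrow> \<phi> (jmul x y) = jmul (\<phi> x) (\<phi> y)"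
  shows "jordan_aut \<phi>"
proof -
  have "bij_betw \<phi> Herm Herm"
    by (rule bij_betw_byWitness[where f' = \<psi>]) (auto simp: assms)
  then show ?thesis
    using assms(5,6) by (simp add: jordan_aut_def linear_iff)
qed

definition permute_entries :: "('n \<Rightarrow> 'n) \<Rightarrow> ('h, 'n::finite) sqmat \<Rightarrow> ('h, 'n) sqmat" where
  "permute_entries \<sigma> x = (\<chi> i j. x $ \<sigma> i $ \<sigma> j)"

lemma jordan_aut_permute_entries:
  assumes "bij \<sigma>"
  shows "jordan_aut (permute_entries \<sigma> :: ('h::hurwitz_algebra, 'n::finite) sqmat \<Rightarrow> _)"
proof (rule jordan_autI[where \<psi> = "permute_entries (inv \<sigma>)"])
  fix x y :: "('h, 'n) sqmat"
  have "(\<Sum>k\<in>UNIV. x $ \<sigma> i $ \<sigma> k * y $ \<sigma> k $ \<sigma> j) = (\<Sum>k\<in>UNIV. x $ \<sigma> i $ k * y $ k $ \<sigma> j)" for x y :: "('h, 'n) sqmat" and i j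
    by (rule sum.reindex_bij_betw[OF assms])
  then show "permute_entries \<sigma> (jmul x y) = jmul (permute_entries \<sigma> x) (permute_entries \<sigma> y)"
    by (simp add: permute_entries_def jmul_def mmul_def vec_eq_iff)
  show "permute_entries (inv \<sigma>) (permute_entries \<sigma> x) = x"
    "permute_entries \<sigma> (permute_entries (inv \<sigma>) x) = x"
    using assms by (simp_all add: permute_entries_def vec_eq_iff bij_is_surj bij_is_inj surj_f_inv_f inv_f_f)
qed (auto simp: permute_entries_def Herm_iff linear_iff vec_eq_iff)

section \<open>Conjugation by unitary matrices\<close>

lemma mmul_mat_1_left: "mmul (mat 1) x = (x :: ('h::hurwitz_algebra, 'n::finite) sqmat)"
  by (simp add: mmul_def mat_def vec_eq_iff if_distrib[of "\<lambda>a. a * _"] hmult_one_left hmult_zero_left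
      cong: if_cong)

lemma mmul_mat_1_right: "mmul x (mat 1) = (x :: ('h::hurwitz_algebra, 'n::finite) sqmat)"
  by (simp add: mmul_def mat_def vec_eq_iff if_distrib[of "\<lambda>a. _ * a"] hmult_one_right hmult_zero_right
      cong: if_cong)

lemma mmul_assoc: "mmul (mmul x y) z = mmul x (mmul y (z :: ('h::assoc_hurwitz, 'n::finite) sqmat))"
proof -
  have "(\<Sum>k\<in>UNIV. \<Sum>l\<in>UNIV. x $ i $ l * (y $ l $ k * z $ k $ j)) =
        (\<Sum>l\<in>UNIV. \<Sum>k\<in>UNIV. x $ i $ l * (y $ l $ k * z $ k $ j))" for i j
    by (rule sum.swap)
  then show ?thesis
    by (simp add: mmul_def vec_eq_iff hmult.sum_left hmult.sum_right hmult_assoc)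
qed

lemma hRe_mtrace_mmul_commute:
  "hRe (mtrace (mmul x y)) = hRe (mtrace (mmul y (x :: ('h::hurwitz_algebra, 'n::finite) sqmat)))"
proof -
  have "hRe (mtrace (mmul x y)) = (\<Sum>i\<in>UNIV. \<Sum>k\<in>UNIV. hRe (y $ k $ i * x $ i $ k))"
    by (simp add: mtrace_def mmul_def hRe_sum hRe_mult_commute)
  also have "\<dots> = hRe (mtrace (mmul y x))"
    by (subst sum.swap) (simp add: mtrace_def mmul_def hRe_sum)
  finally show ?thesis .
qed

text \<open>Both products are required, which spares the argument that a one-sided inverse of a square matrix over a
  noncommutative algebra is two-sided.\<close>

definition unitary :: "('h::conj_algebra, 'n::finite) sqmat \<Rightarrow> bool" where
  "unitary u \<longleftrightarrow> mmul u (conj_transpose u) = mat 1 \<and> mmul (conj_transpose u) u = mat 1"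

definition conjugate_by :: "('h::conj_algebra, 'n::finite) sqmat \<Rightarrow> ('h, 'n) sqmat \<Rightarrow> ('h, 'n) sqmat" where
  "conjugate_by u x = mmul (mmul u x) (conj_transpose u)"

lemma conj_transpose_mat_1: "conj_transpose (mat 1) = mat 1"
  by (auto simp: conj_transpose_def mat_def vec_eq_iff hconj_one hconj_zero)

lemma unitary_mat_1: "unitary (mat 1 :: ('h::hurwitz_algebra, 'n::finite) sqmat)"
  by (simp add: unitary_def conj_transpose_mat_1 mmul_mat_1_left)

lemma unitary_cancel:
  fixes u :: "('h::assoc_hurwitz, 'n::finite) sqmat"
  assumes "unitary u"
  shows "mmul u (mmul (conj_transpose u) x) = x" "mmul (conj_transpose u) (mmul u x) = x"
  using assms by (simp_all add: unitary_def mmul_mat_1_left flip: mmul_assoc)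

lemma unitary_mmul:
  fixes u v :: "('h::assoc_hurwitz, 'n::finite) sqmat"
  assumes "unitary u" "unitary v"
  shows "unitary (mmul u v)"
  unfolding unitary_def conj_transpose_mmul mmul_assoc
  using assms by (simp add: unitary_cancel) (simp add: unitary_def)

lemma conjugate_by_mmul:
  fixes u :: "('h::assoc_hurwitz, 'n::finite) sqmat"
  shows "unitary u \<Longrightarrow> conjugate_by u (mmul x y) = mmul (conjugate_by u x) (conjugate_by u y)"
  by (simp add: conjugate_by_def mmul_assoc unitary_cancel)

lemma linear_conjugate_by: "linear (conjugate_by (u :: ('h::hurwitz_algebra, 'n::finite) sqmat))"
  by (simp add: linear_iff conjugate_by_def mmul.add_left mmul.add_right mmul.scaleR_left mmul.scaleR_right)

lemma conj_transpose_conjugate_by: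
  "conj_transpose (conjugate_by u x) = conjugate_by u (conj_transpose (x :: ('h::assoc_hurwitz, 'n::finite) sqmat))"
  by (simp add: conjugate_by_def conj_transpose_mmul mmul_assoc)

lemma conjugate_by_conjugate_by:
  "conjugate_by u (conjugate_by v x) = conjugate_by (mmul u v) (x :: ('h::assoc_hurwitz, 'n::finite) sqmat)"
  by (simp add: conjugate_by_def conj_transpose_mmul mmul_assoc)

lemma Herm_conjugate_by: "x \<in> Herm \<Longrightarrow> conjugate_by u x \<in> (Herm :: ('h::assoc_hurwitz, 'n::finite) sqmat set)"
  by (simp add: Herm_def conj_transpose_conjugate_by)

lemma frob_conjugate_by:
  fixes u :: "('h::assoc_hurwitz, 'n::finite) sqmat"
  assumes "unitary u"
  shows "frob (conjugate_by u x) (conjugate_by u y) = frob x y"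
proof -
  have "frob (conjugate_by u x) (conjugate_by u y)
      = hRe (mtrace (conjugate_by u (mmul (conj_transpose x) y)))"
    using assms by (simp add: frob_def conj_transpose_conjugate_by conjugate_by_mmul)
  also have "\<dots> = hRe (mtrace (mmul (conj_transpose u) (mmul u (mmul (conj_transpose x) y))))"
    unfolding conjugate_by_def by (rule hRe_mtrace_mmul_commute)
  also have "\<dots> = frob x y" using assms by (simp add: unitary_cancel frob_def)
  finally show ?thesis .
qed

lemma comm_conjugate_by:
  fixes u :: "('h::assoc_hurwitz, 'n::finite) sqmat"
  shows "unitary u \<Longrightarrow> comm (conjugate_by u x) (conjugate_by u y) = conjugate_by u (comm x y)"
  by (simp add: comm_def linear_diff[OF linear_conjugate_by] conjugate_by_mmul)

lemma jordan_aut_conjugate_by: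
  fixes u :: "('h::assoc_hurwitz, 'n::finite) sqmat"
  assumes u: "unitary u"
  shows "jordan_aut (conjugate_by u)"
proof (rule jordan_autI[where \<psi> = "conjugate_by (conj_transpose u)"])
  have one: "conjugate_by (mat 1) x = x" for x :: "('h, 'n) sqmat"
    by (simp add: conjugate_by_def conj_transpose_mat_1 mmul_mat_1_left mmul_mat_1_right)
  show "conjugate_by (conj_transpose u) (conjugate_by u x) = x"
    "conjugate_by u (conjugate_by (conj_transpose u) x) = x" for x
    using u by (simp_all add: conjugate_by_conjugate_by unitary_def one)
  show "conjugate_by u (jmul x y) = jmul (conjugate_by u x) (conjugate_by u y)" for x y
    using u by (simp add: jmul_def linear_scale[OF linear_conjugate_by] linear_add[OF linear_conjugate_by]
        conjugate_by_mmul)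
qed (simp_all add: Herm_conjugate_by linear_conjugate_by)

section \<open>Diagonalisation\<close>

definition diag_mat :: "('n \<Rightarrow> 'h::conj_algebra) \<Rightarrow> ('h, 'n::finite) sqmat" where
  "diag_mat d = (\<chi> k l. if k = l then d k else 0)"

lemma mmul_diag_mat_left: "mmul (diag_mat d) x = (\<chi> k l. d k * (x $ k $ l :: 'h::hurwitz_algebra))"
  by (simp add: mmul_def diag_mat_def vec_eq_iff if_distrib[of "\<lambda>a. a * _"] hmult_zero_left cong: if_cong)

lemma mmul_diag_mat_right: "mmul x (diag_mat d) = (\<chi> k l. (x $ k $ l :: 'h::hurwitz_algebra) * d l)"
  by (simp add: mmul_def diag_mat_def vec_eq_iff if_distrib[of "\<lambda>a. _ * a"] hmult_zero_right cong: if_cong)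

lemma conj_transpose_diag_mat: "conj_transpose (diag_mat d) = diag_mat (\<lambda>k. hconj (d k))"
  by (auto simp: conj_transpose_def diag_mat_def vec_eq_iff hconj_zero)

lemma conjugate_by_diag_mat:
  "conjugate_by (diag_mat d) x $ k $ l = d k * x $ k $ l * hconj (d l :: 'h::hurwitz_algebra)"
  by (simp add: conjugate_by_def conj_transpose_diag_mat mmul_diag_mat_left mmul_diag_mat_right)

lemma unitary_diag_mat:
  assumes "\<And>k. norm (d k :: 'h::hurwitz_algebra) = 1"
  shows "unitary (diag_mat d)"
  using assms by (simp add: unitary_def conj_transpose_diag_mat mmul_diag_mat_left)
    (simp add: vec_eq_iff diag_mat_def mat_def mult_hconj_self hconj_mult_self hmult_zero_right)

text \<open>The matrix \<open>u\<close> is diagonal with entry \<open>hconj z / |z|\<close> at place \<open>i\<close> and ones elsewhere. Being a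
  phase, it fixes real diagonal entries and zeros.\<close>

lemma unitary_phase:
  fixes z :: "'h::assoc_hurwitz" and i j :: "'n::finite"
  assumes "i \<noteq> j" "z \<noteq> 0"
  obtains u :: "('h, 'n) sqmat" where "unitary u"
    "\<And>x. x $ i $ j = z \<Longrightarrow> conjugate_by u x $ i $ j = scaleR (norm z) 1"
    "\<And>x k l r. x $ k $ l = scaleR r 1 \<Longrightarrow> k = l \<or> r = 0 \<Longrightarrow> conjugate_by u x $ k $ l = scaleR r 1"
proof -
  let ?d = "\<lambda>k. if k = i then scaleR (1 / norm z) (hconj z) else 1"
  show thesis
  proof
    show "unitary (diag_mat ?d)"
      by (rule unitary_diag_mat) (simp add: norm_hconj norm_one_hurwitz assms)
    show "conjugate_by (diag_mat ?d) x $ i $ j = scaleR (norm z) 1" if "x $ i $ j = z" for x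
      using assms that by (simp add: conjugate_by_diag_mat hmult_scaleR_left hconj_mult_self hconj_one
          hmult_one_right power2_eq_square)
    show "conjugate_by (diag_mat ?d) x $ k $ l = scaleR r 1"
      if "x $ k $ l = scaleR r 1" "k = l \<or> r = 0" for x k l r
      using assms that by (auto simp: conjugate_by_diag_mat hmult_scaleR_left hmult_scaleR_right
          hmult_one_right hconj_scaleR hconj_hconj hconj_mult_self hconj_one power2_eq_square
          hmult_zero_right hmult_zero_left)
  qed
qed

definition plane_rotation :: "'n \<Rightarrow> 'n \<Rightarrow> real \<Rightarrow> real \<Rightarrow> ('h::conj_algebra, 'n::finite) sqmat" where
  "plane_rotation i j c s = (\<chi> k l.
     if k = i then (if l = i then scaleR c 1 else if l = j then scaleR s 1 else 0)
     else if k = j then (if l = i then scaleR (- s) 1 else if l = j then scaleR c 1 else 0)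
     else if k = l then 1 else 0)"

lemma mmul_plane_rotation:
  fixes x :: "('h::hurwitz_algebra, 'n::finite) sqmat"
  assumes ij: "i \<noteq> j"
  shows "mmul (plane_rotation i j c s) x = (\<chi> k l.
     if k = i then scaleR c (x $ i $ l) + scaleR s (x $ j $ l)
     else if k = j then scaleR (- s) (x $ i $ l) + scaleR c (x $ j $ l) else x $ k $ l)"
proof -
  have two: "(\<Sum>p\<in>UNIV. (if p = i then scaleR a 1 else if p = j then scaleR b 1 else 0) * f p)
      = scaleR a (f i) + scaleR b (f j)" for a b and f :: "'n \<Rightarrow> 'h"
  proof -
    have "(\<Sum>p\<in>UNIV. (if p = i then scaleR a 1 else if p = j then scaleR b 1 else 0) * f p)
        = (\<Sum>p\<in>UNIV. (if p = i then scaleR a (f i) else 0) + (if p = j then scaleR b (f j) else 0))"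
      using ij by (intro sum.cong) (auto simp: hmult_scaleR_left hmult_one_left hmult_zero_left)
    then show ?thesis by (simp add: sum.distrib)
  qed
  have one: "(\<Sum>p\<in>UNIV. (if k = p then 1 else 0) * f p) = f k" for k and f :: "'n \<Rightarrow> 'h"
    by (simp add: if_distrib[of "\<lambda>a. a * _"] hmult_one_left hmult_zero_left cong: if_cong)
  have "mmul (plane_rotation i j c s) x $ k $ l =
     (if k = i then scaleR c (x $ i $ l) + scaleR s (x $ j $ l)
     else if k = j then scaleR (- s) (x $ i $ l) + scaleR c (x $ j $ l) else x $ k $ l)" for k l
    unfolding mmul_def plane_rotation_def
    using two[of c s "\<lambda>p. x $ p $ l"] two[of "- s" c "\<lambda>p. x $ p $ l"] one[of k "\<lambda>p. x $ p $ l"]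
    by simp
  then show ?thesis by (simp add: vec_eq_iff)
qed

lemma conj_transpose_plane_rotation:
  "i \<noteq> j \<Longrightarrow> conj_transpose (plane_rotation i j c s) = plane_rotation i j c (- s)"
  by (simp add: conj_transpose_def plane_rotation_def vec_eq_iff hconj_scaleR hconj_one hconj_zero hconj_minus)

lemma unitary_plane_rotation:
  assumes "i \<noteq> j" "c\<^sup>2 + s\<^sup>2 = 1"
  shows "unitary (plane_rotation i j c s :: ('h::hurwitz_algebra, 'n::finite) sqmat)"
proof -
  have "mmul (plane_rotation i j c s) (plane_rotation i j c (- s)) = (mat 1 :: ('h, 'n) sqmat)"
    if "c\<^sup>2 + s\<^sup>2 = 1" for s
    unfolding mmul_plane_rotation[OF assms(1)]
    using assms(1) that
    by (simp add: plane_rotation_def mat_def vec_eq_iff power2_eq_square add.commute flip: scaleR_add_left scaleR_diff_left)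
  from this[of s] this[of "- s"] show ?thesis
    using assms by (simp add: unitary_def conj_transpose_plane_rotation)
qed

lemma conjugate_by_plane_rotation_diagonal:
  fixes x :: "('h::hurwitz_algebra, 'n::finite) sqmat"
  assumes "i \<noteq> j"
  shows "conjugate_by (plane_rotation i j c s) x $ k $ k =
    (if k = i then scaleR (c\<^sup>2) (x $ i $ i) + scaleR (c * s) (x $ i $ j + x $ j $ i) + scaleR (s\<^sup>2) (x $ j $ j)
     else if k = j then scaleR (s\<^sup>2) (x $ i $ i) - scaleR (c * s) (x $ i $ j + x $ j $ i) + scaleR (c\<^sup>2) (x $ j $ j)
     else x $ k $ k)"
proof -
  let ?g = "plane_rotation i j c s"
  have "conjugate_by ?g x = conj_transpose (mmul ?g (conj_transpose (mmul ?g x)))"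
    by (simp add: conjugate_by_def conj_transpose_mmul)
  then show ?thesis
    using assms by (simp add: mmul_plane_rotation conj_transpose_def hconj_add hconj_scaleR hconj_hconj
      hconj_minus hconj_diff power2_eq_square algebra_simps)
qed

text \<open>The Frobenius norm is invariant under conjugation by unitary matrices, so for Hermitian matrices
  maximising this quantity means minimising the off-diagonal part.\<close>

definition diagonal_energy :: "('h::conj_algebra, 'n::finite) sqmat \<Rightarrow> real" where
  "diagonal_energy x = (\<Sum>k\<in>UNIV. (hRe (x $ k $ k))\<^sup>2)"

text \<open>Conjugating the symmetric matrix \<open>((a, t), (t, b))\<close> by a rotation yields the two diagonal entries
  squared here. Their sum is \<open>a + b\<close> for every angle, and for the angle that diagonalises the matrix the square of
  their difference grows from \<open>(a - b)\<^sup>2\<close> to \<open>(a - b)\<^sup>2 + 4 t\<^sup>2\<close>.\<close>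

lemma jacobi_angle:
  fixes a b t :: real
  assumes "t \<noteq> 0"
  obtains c s where "c\<^sup>2 + s\<^sup>2 = 1"
    "(c\<^sup>2 * a + c * s * (2 * t) + s\<^sup>2 * b)\<^sup>2 + (s\<^sup>2 * a - c * s * (2 * t) + c\<^sup>2 * b)\<^sup>2 > a\<^sup>2 + b\<^sup>2"
proof -
  define R where "R = sqrt ((a - b)\<^sup>2 + 4 * t\<^sup>2)"
  have R2: "R\<^sup>2 = (a - b)\<^sup>2 + 4 * t\<^sup>2" unfolding R_def by simp
  have "0 < 4 * t\<^sup>2" using assms by simp
  then have "R \<noteq> 0" using R2 by (metis add_nonneg_pos less_numeral_extra(3) zero_le_power2 zero_eq_power2)
  then have "((a - b) / R)\<^sup>2 + (2 * t / R)\<^sup>2 = 1"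
    by (simp add: power_divide R2 power_mult_distrib flip: add_divide_distrib)
       (metis R2 power_not_zero)
  then obtain \<theta> where th: "(a - b) / R = cos \<theta>" "2 * t / R = sin \<theta>"
    using sincos_total_2pi by metis
  define c where "c = cos (\<theta> / 2)"
  define s where "s = sin (\<theta> / 2)"
  have cs: "c\<^sup>2 + s\<^sup>2 = 1" by (simp add: c_def s_def)
  have dbl: "(a - b) / R = c\<^sup>2 - s\<^sup>2" "2 * t / R = 2 * s * c"
    unfolding th c_def s_def using cos_double[of "\<theta> / 2"] sin_double[of "\<theta> / 2"] by simp_all
  define p where "p = c\<^sup>2 * a + c * s * (2 * t) + s\<^sup>2 * b"
  define q where "q = s\<^sup>2 * a - c * s * (2 * t) + c\<^sup>2 * b"
  have "p + q = (c\<^sup>2 + s\<^sup>2) * (a + b)" unfolding p_def q_def by algebra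
  then have sum: "p + q = a + b" using cs by simp
  have "p - q = (c\<^sup>2 - s\<^sup>2) * (a - b) + (2 * s * c) * (2 * t)" unfolding p_def q_def by algebra
  also have "\<dots> = R\<^sup>2 / R" unfolding dbl[symmetric] R2 by (simp add: power2_eq_square add_divide_distrib)
  also have "\<dots> = R" by (simp add: power2_eq_square)
  finally have diff: "(p - q)\<^sup>2 = (a - b)\<^sup>2 + 4 * t\<^sup>2" by (simp add: R2)
  have "2 * (p\<^sup>2 + q\<^sup>2) = (p + q)\<^sup>2 + (p - q)\<^sup>2" by algebra
  also have "\<dots> = 2 * (a\<^sup>2 + b\<^sup>2) + 4 * t\<^sup>2" unfolding sum diff by algebra
  finally have "p\<^sup>2 + q\<^sup>2 > a\<^sup>2 + b\<^sup>2" using \<open>0 < 4 * t\<^sup>2\<close> by argo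
  then show thesis using that cs unfolding p_def q_def by blast
qed

text \<open>A diagonal phase first makes the offending entry real without changing the diagonal, so that a
  rotation with real coefficients can be applied even over the quaternions.\<close>

lemma diagonal_energy_improve:
  fixes x :: "('h::assoc_hurwitz, 'n::finite) sqmat"
  assumes x: "x \<in> Herm" and "i \<noteq> j" "x $ i $ j \<noteq> 0"
  obtains u where "unitary u" "diagonal_energy (conjugate_by u x) > diagonal_energy x"
proof -
  define z where "z = x $ i $ j"
  obtain v :: "('h, 'n) sqmat" where v: "unitary v"
    "\<And>x. x $ i $ j = z \<Longrightarrow> conjugate_by v x $ i $ j = scaleR (norm z) 1"
    and v': "\<And>x k l r. x $ k $ l = scaleR r 1 \<Longrightarrow> k = l \<or> r = 0 \<Longrightarrow> conjugate_by v x $ k $ l = scaleR r 1"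
    by (rule unitary_phase[of i j z]) (use assms in \<open>simp_all add: z_def\<close>)
  define y where "y = conjugate_by v x"
  have y: "y \<in> Herm" using x by (simp add: y_def Herm_conjugate_by)
  have yij: "y $ i $ j = scaleR (norm z) 1" unfolding y_def by (rule v(2)) (simp add: z_def)
  then have yji: "y $ j $ i = scaleR (norm z) 1" 
    using HermD[OF y, of i j] by (simp add: hconj_scaleR hconj_one)
  have "hRe (y $ k $ k) = hRe (x $ k $ k)" for k
    using v'[OF Herm_diagonal_entry[OF x, of k]] by (simp add: y_def hRe_scaleR hRe_one)
  then have ey: "diagonal_energy y = diagonal_energy x" by (simp add: diagonal_energy_def)
  define a where "a = hRe (y $ i $ i)"
  define b where "b = hRe (y $ j $ j)"
  have "norm z \<noteq> 0" using assms by (simp add: z_def)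
  from jacobi_angle[OF this, of a b] obtain c s where cs: "c\<^sup>2 + s\<^sup>2 = 1" and
    gt: "(c\<^sup>2 * a + c * s * (2 * norm z) + s\<^sup>2 * b)\<^sup>2 + (s\<^sup>2 * a - c * s * (2 * norm z) + c\<^sup>2 * b)\<^sup>2 > a\<^sup>2 + b\<^sup>2" .
  let ?g = "plane_rotation i j c s :: ('h, 'n) sqmat"
  let ?w = "conjugate_by ?g y"
  have split: "diagonal_energy m = (hRe (m $ i $ i))\<^sup>2 + (hRe (m $ j $ j))\<^sup>2 + (\<Sum>k\<in>UNIV - {i} - {j}. (hRe (m $ k $ k))\<^sup>2)"
    for m :: "('h, 'n) sqmat"
    unfolding diagonal_energy_def using \<open>i \<noteq> j\<close>
    by (simp add: sum.remove[of UNIV i] sum.remove[of "UNIV - {i}" j])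
  have wi: "hRe (?w $ i $ i) = c\<^sup>2 * a + c * s * (2 * norm z) + s\<^sup>2 * b"
    and wj: "hRe (?w $ j $ j) = s\<^sup>2 * a - c * s * (2 * norm z) + c\<^sup>2 * b"
    using \<open>i \<noteq> j\<close> by (simp_all add: conjugate_by_plane_rotation_diagonal a_def b_def yij yji
        hRe_add hRe_diff hRe_scaleR hRe_one)
  have wk: "?w $ k $ k = y $ k $ k" if "k \<in> UNIV - {i} - {j}" for k
    using that \<open>i \<noteq> j\<close> by (simp add: conjugate_by_plane_rotation_diagonal)
  have "diagonal_energy ?w > diagonal_energy y"
    unfolding split wi wj using gt by (simp add: wk a_def b_def)
  moreover have "?w = conjugate_by (mmul ?g v) x"
    by (simp add: y_def conjugate_by_conjugate_by)
  moreover have "unitary (mmul ?g v)"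
    using v(1) cs \<open>i \<noteq> j\<close> by (simp add: unitary_mmul unitary_plane_rotation)
  ultimately show thesis using that ey by metis
qed

lemma compact_unitary: "compact {u :: ('h::hurwitz_algebra, 'n::finite) sqmat. unitary u}"
proof -
  have ct: "continuous_on UNIV (conj_transpose :: ('h, 'n) sqmat \<Rightarrow> _)"
    by (rule linear_continuous_on) (use linear_conj_transpose in \<open>simp only: linear_conv_bounded_linear\<close>)
  have "closed {u :: ('h, 'n) sqmat. mmul u (conj_transpose u) = mat 1}"
    "closed {u :: ('h, 'n) sqmat. mmul (conj_transpose u) u = mat 1}"
    by (intro closed_Collect_eq mmul.continuous_on ct continuous_on_id continuous_on_const)+
  then have "closed {u :: ('h, 'n) sqmat. unitary u}"
    unfolding unitary_def by (rule closed_Collect_conj)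
  moreover have "norm u \<le> sqrt (hRe (mtrace (mat 1 :: ('h, 'n) sqmat)))" if "unitary u" for u :: "('h, 'n) sqmat"
  proof -
    have "(norm u)\<^sup>2 = hRe (mtrace (mat 1 :: ('h, 'n) sqmat))"
      using that by (simp add: norm_sq_eq_norm[symmetric] norm_sq_def frob_def unitary_def)
    then show ?thesis by (metis norm_ge_zero order_refl real_sqrt_unique)
  qed
  then have "bounded {u :: ('h, 'n) sqmat. unitary u}"
    by (auto simp: bounded_iff)
  ultimately show ?thesis by (simp add: compact_eq_bounded_closed)
qed

theorem unitary_diagonalisation:
  fixes x :: "('h::assoc_hurwitz, 'n::finite) sqmat"
  assumes x: "x \<in> Herm"
  obtains u where "unitary u" "diagonal (conjugate_by u x)"
proof -
  let ?U = "{u :: ('h, 'n) sqmat. unitary u}"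
  have ct: "continuous_on ?U (conj_transpose :: ('h, 'n) sqmat \<Rightarrow> _)"
    by (rule linear_continuous_on) (use linear_conj_transpose in \<open>simp only: linear_conv_bounded_linear\<close>)
  have re: "continuous_on UNIV (hRe :: 'h \<Rightarrow> real)"
    by (rule linear_continuous_on) (use linear_hRe in \<open>simp only: linear_conv_bounded_linear\<close>)
  have "continuous_on ?U (\<lambda>u. conjugate_by u x)"
    unfolding conjugate_by_def
    by (intro mmul.continuous_on ct continuous_on_id continuous_on_const)
  then have "continuous_on ?U (\<lambda>u. diagonal_energy (conjugate_by u x))"
    unfolding diagonal_energy_def
    by (intro continuous_on_sum continuous_on_power continuous_on_compose2[OF re] continuous_on_component) auto
  then obtain u where u: "unitary u"
    and mx: "\<And>v. unitary v \<Longrightarrow> diagonal_energy (conjugate_by v x) \<le> diagonal_energy (conjugate_by u x)"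
    using continuous_attains_sup[OF compact_unitary] unitary_mat_1 by (metis empty_iff mem_Collect_eq)
  have "diagonal (conjugate_by u x)"
  proof (rule ccontr)
    assume "\<not> diagonal (conjugate_by u x)"
    then obtain i j where "i \<noteq> j" "conjugate_by u x $ i $ j \<noteq> 0" by (auto simp: diagonal_def)
    then obtain v where "unitary v"
      "diagonal_energy (conjugate_by v (conjugate_by u x)) > diagonal_energy (conjugate_by u x)"
      using diagonal_energy_improve[OF Herm_conjugate_by[OF x]] by metis
    then show False using mx[of "mmul v u"] u by (simp add: conjugate_by_conjugate_by unitary_mmul)
  qed
  with u show thesis using that by blast
qed

section \<open>Moufang identities\<close>

text \<open>Conjugation is \<open>2 Re x - x\<close>, so the cancellation axiom is the left alternative law in disguise.\<close>

lemma left_alternative: "x * (x * y) = (x * x) * (y :: 'h::hurwitz_algebra)"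
proof -
  have "scaleR (2 * hRe x) (x * y) - x * (x * y) = scaleR ((norm x)\<^sup>2) y" for y
    using hconj_mult_cancel[of x y]
    by (simp add: hconj_eq[of x] hmult.diff_left hmult_scaleR_left hmult_one_left)
  from this[of y] this[of 1] show ?thesis
    by (simp add: hmult_one_right diff_eq_eq hmult_add_left hmult_scaleR_left hmult_one_left
        hmult.diff_left eq_diff_eq flip: hmult.diff_left)
      (metis (no_types, opaque_lifting) add_diff_cancel_left' hmult.diff_left hmult_one_left hmult_scaleR_left)
qed

definition associator :: "'h::hurwitz_algebra \<Rightarrow> 'h \<Rightarrow> 'h \<Rightarrow> 'h" where
  "associator x y z = (x * y) * z - x * (y * z)"

text \<open>The associator is alternating: it vanishes when its first two arguments agree, and polarising gives
  antisymmetry. Conjugation reverses the arguments and transfers this to the last two.\<close>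

lemma associator_swap_left: "associator x y z = - associator y x (z :: 'h::hurwitz_algebra)"
proof -
  have "associator (x + y) (x + y) z = 0" "associator x x z = 0" "associator y y z = 0"
    by (simp_all add: associator_def left_alternative)
  then have "associator x y z + associator y x z = 0"
    by (simp add: associator_def hmult_add_left hmult_add_right algebra_simps)
  then show ?thesis by (simp add: eq_neg_iff_add_eq_0)
qed

lemma hconj_associator:
  "hconj (associator x y z) = - associator (hconj z) (hconj y) (hconj (x :: 'h::hurwitz_algebra))"
  by (simp add: associator_def hconj_diff hconj_mult)

lemma associator_swap_right: "associator x y z = - associator x z (y :: 'h::hurwitz_algebra)"
proof -
  have "hconj (associator x y z) = hconj (- associator x z y)"
    unfolding hconj_minus hconj_associator by (simp add: associator_swap_left[of "hconj z"])
  then show ?thesis by (metis hconj_hconj)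
qed

lemma flexible: "(x * y) * x = x * (y * (x :: 'h::hurwitz_algebra))"
proof -
  have "associator x y x = - associator x x y" by (rule associator_swap_right)
  then show ?thesis by (simp add: associator_def left_alternative)
qed

text \<open>Negating the imaginary part of an argument negates the associator, so conjugation, which also reverses
  the arguments, takes the associator to its negative. Hence associators have no real part.\<close>

lemma hRe_mult_assoc: "hRe ((x * y) * z) = hRe (x * (y * (z :: 'h::hurwitz_algebra)))"
proof -
  have conj1: "associator (hconj x) y z = - associator x y z" for x y z :: 'h
    by (simp add: associator_def hconj_eq[of x] hmult.diff_left hmult_scaleR_left hmult_one_left)
  have "hconj (associator x y z) = - associator (hconj z) (hconj y) (hconj x)"
    by (rule hconj_associator)
  also have "\<dots> = associator z (hconj y) (hconj x)" by (simp add: conj1)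
  also have "\<dots> = - associator (hconj y) z (hconj x)" by (rule associator_swap_left)
  also have "\<dots> = associator y z (hconj x)" by (simp add: conj1)
  also have "\<dots> = associator (hconj x) y z"
    by (simp add: associator_swap_right[of y z] associator_swap_left[of y "hconj x"])
  finally have "hconj (associator x y z) = - associator x y z" by (simp add: conj1)
  then have "hRe (associator x y z) = - hRe (associator x y z)"
    by (metis hRe_hconj hRe_minus)
  then show ?thesis by (simp add: associator_def hRe_diff)
qed

text \<open>The difference of the two sides is a sum of two associators. Swapping their arguments makes it
  symmetric in \<open>y\<close> and \<open>z\<close>, and what remains is the left alternative law applied to \<open>y z + z y\<close>.\<close>

lemma moufang_left: "(x * (y * x)) * z = x * (y * (x * (z :: 'h::hurwitz_algebra)))"
proof -
  have split: "(a * b) * c = a * (b * c) + associator a b c" for a b c :: 'h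
    by (simp add: associator_def)
  have "(x * (y * x)) * z - x * (y * (x * z)) = associator (x * y) x z + associator x y (x * z)"
    by (simp add: associator_def flip: flexible)
  also have "\<dots> = - (associator x (x * y) z + associator x (x * z) y)"
    by (simp add: associator_swap_left[of "x * y"] associator_swap_right[of x y])
  also have "\<dots> = x * ((x * y) * z + (x * z) * y) - (((x * x) * y) * z + ((x * x) * z) * y)"
    by (simp add: associator_def left_alternative hmult_add_right)
  also have "\<dots> = x * (x * (y * z + z * y)) - (x * x) * (y * z + z * y)"
    by (simp add: split[of "x * x" y z] split[of "x * x" z y] split[of x y z] split[of x z y]
        associator_swap_right[of _ z y] hmult_add_right)
  also have "\<dots> = 0" by (simp add: left_alternative)
  finally show ?thesis by simp
qed

lemma moufang_right: "z * (x * (y * x)) = ((z * x) * y) * (x :: 'h::hurwitz_algebra)"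
  using arg_cong[OF moufang_left[of "hconj x" "hconj y" "hconj z"], of hconj]
  by (simp add: hconj_mult hconj_hconj flexible)

lemma inner_mult_left: "inner (w * x) (w * y) = (norm w)\<^sup>2 * inner x (y :: 'h::hurwitz_algebra)"
proof -
  have "inner (w * x) (w * y) = inner x (hconj w * (w * y))"
    by (simp add: inner_eq_hRe hconj_mult hRe_mult_assoc)
  then show ?thesis by (simp add: hconj_mult_cancel)
qed

lemma inner_mult_right: "inner (x * w) (y * w) = (norm w)\<^sup>2 * inner x (y :: 'h::hurwitz_algebra)"
  using inner_mult_left[of "hconj w" "hconj x" "hconj y"] inner_hconj[of "x * w" "y * w"]
  by (simp only: hconj_mult norm_hconj inner_hconj)

section \<open>Hermitian matrices of size three\<close>

text \<open>The off-diagonal entries are stored at the cyclic positions \<open>(p, q)\<close>, \<open>(q, r)\<close>, \<open>(r, p)\<close>, so that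
  the Jordan product below is invariant under cyclic rotation of the three indices.\<close>

definition herm3 :: "'n \<Rightarrow> 'n \<Rightarrow> 'n \<Rightarrow> real \<Rightarrow> real \<Rightarrow> real \<Rightarrow> 'h \<Rightarrow> 'h \<Rightarrow> 'h \<Rightarrow> ('h::conj_algebra, 'n::finite) sqmat" where
  "herm3 p q r \<alpha> \<beta> \<gamma> a b c = (\<chi> k l.
     if k = p then (if l = p then scaleR \<alpha> 1 else if l = q then a else hconj c)
     else if k = q then (if l = p then hconj a else if l = q then scaleR \<beta> 1 else b)
     else (if l = p then c else if l = q then hconj b else scaleR \<gamma> 1))"

locale three_indices =
  fixes p q r :: "'n::finite"
  assumes UNIV_pqr: "UNIV = {p, q, r}" and distinct_pqr: "p \<noteq> q" "q \<noteq> r" "p \<noteq> r"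
begin

lemma all_pqr: "(\<forall>k. P k) \<longleftrightarrow> P p \<and> P q \<and> P r"
  using UNIV_pqr by (metis UNIV_I insert_iff singletonD)

lemma herm3_in_Herm: "herm3 p q r \<alpha> \<beta> \<gamma> a b c \<in> Herm"
  using distinct_pqr by (simp add: Herm_iff all_pqr herm3_def hconj_scaleR hconj_one hconj_hconj)

lemma Herm_eq_herm3:
  fixes x :: "('h::hurwitz_algebra, 'n) sqmat"
  assumes "x \<in> Herm"
  shows "x = herm3 p q r (hRe (x $ p $ p)) (hRe (x $ q $ q)) (hRe (x $ r $ r)) (x $ p $ q) (x $ q $ r) (x $ r $ p)"
  using distinct_pqr HermD[OF assms] Herm_diagonal_entry[OF assms, symmetric]
  by (simp add: vec_eq_iff all_pqr herm3_def)

lemma herm3_entries: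
  fixes \<alpha> \<beta> \<gamma> and a b c :: "'h::hurwitz_algebra"
  defines "m \<equiv> herm3 p q r \<alpha> \<beta> \<gamma> a b c"
  shows "hRe (m $ p $ p) = \<alpha>" "hRe (m $ q $ q) = \<beta>" "hRe (m $ r $ r) = \<gamma>"
    "m $ p $ q = a" "m $ q $ r = b" "m $ r $ p = c"
  using distinct_pqr by (simp_all add: m_def herm3_def hRe_scaleR hRe_one)

text \<open>Each off-diagonal entry of the product involves only one product of two off-diagonal entries at a
  time, so products of three algebra elements never occur.\<close>

lemma jmul_herm3:
  fixes a b c a' b' c' :: "'h::hurwitz_algebra"
  shows "jmul (herm3 p q r \<alpha> \<beta> \<gamma> a b c) (herm3 p q r \<alpha>' \<beta>' \<gamma>' a' b' c') = herm3 p q r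
    (\<alpha> * \<alpha>' + inner a a' + inner c c') (\<beta> * \<beta>' + inner a a' + inner b b') (\<gamma> * \<gamma>' + inner b b' + inner c c')
    (scaleR (1/2) (scaleR (\<alpha> + \<beta>) a' + scaleR (\<alpha>' + \<beta>') a + hconj (b * c' + b' * c)))
    (scaleR (1/2) (scaleR (\<beta> + \<gamma>) b' + scaleR (\<beta>' + \<gamma>') b + hconj (c * a' + c' * a)))
    (scaleR (1/2) (scaleR (\<gamma> + \<alpha>) c' + scaleR (\<gamma>' + \<alpha>') c + hconj (a * b' + a' * b)))"
  (is "?L = ?R")
proof -
  have sum3: "(\<Sum>k\<in>UNIV. f k) = f p + f q + f r" for f :: "'n \<Rightarrow> 'h"
    using distinct_pqr by (simp add: UNIV_pqr add.assoc)
  have H: "?L \<in> Herm" "?R \<in> Herm" by (simp_all add: herm3_in_Herm Herm_jmul)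
  have dl: "x * hconj y = scaleR (2 * inner x y) 1 - y * hconj x" for x y :: 'h
    using mult_hconj_plus[of x y] by (simp add: eq_diff_eq)
  have dr: "hconj x * y = scaleR (2 * inner x y) 1 - hconj y * x" for x y :: 'h
    using mult_hconj_plus[of "hconj x" "hconj y"] by (simp add: eq_diff_eq hconj_hconj inner_hconj)
  note entry = jmul_def mmul_def sum3 herm3_def hmult_scaleR_left hmult_scaleR_right hmult_one_left
    hmult_one_right hconj_mult hconj_add hconj_hconj
  have diag: "?L $ p $ p = ?R $ p $ p" "?L $ q $ q = ?R $ q $ q" "?L $ r $ r = ?R $ r $ r"
    using distinct_pqr
    by (simp_all add: entry dl[of a a'] dl[of b b'] dr[of a a'] dr[of b b'] dl[of c c'] dr[of c c']
        algebra_simps) (simp_all flip: scaleR_add_left)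
  have off: "?L $ p $ q = ?R $ p $ q" "?L $ q $ r = ?R $ q $ r" "?L $ r $ p = ?R $ r $ p"
    using distinct_pqr by (simp_all add: entry algebra_simps)
  have "?L = herm3 p q r (hRe (?L $ p $ p)) (hRe (?L $ q $ q)) (hRe (?L $ r $ r)) (?L $ p $ q) (?L $ q $ r) (?L $ r $ p)"
    by (rule Herm_eq_herm3) (rule H)
  also have "\<dots> = ?R" unfolding diag off by (rule Herm_eq_herm3[symmetric]) (rule H)
  finally show ?thesis .
qed

text \<open>By \<open>jmul_herm3\<close> the only products of algebra elements in the Jordan product are the inner products
  of entries at the same place and the conjugates of products of cyclically neighbouring entries. A
  triple of isometries compatible with the latter is therefore an automorphism.\<close>

lemma jordan_aut_triality:
  fixes A B C :: "'h::hurwitz_algebra \<Rightarrow> 'h"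
  assumes "linear A" "linear B" "linear C"
    and iso: "\<And>x y. inner (A x) (A y) = inner x y" "\<And>x y. inner (B x) (B y) = inner x y"
       "\<And>x y. inner (C x) (C y) = inner x y"
    and inv: "\<And>x. A' (A x) = x" "\<And>x. B' (B x) = x" "\<And>x. C' (C x) = x"
       "\<And>x. A (A' x) = x" "\<And>x. B (B' x) = x" "\<And>x. C (C' x) = x"
    and tri: "\<And>b c. hconj (B b * C c) = A (hconj (b * c))" "\<And>c a. hconj (C c * A a) = B (hconj (c * a))"
       "\<And>a b. hconj (A a * B b) = C (hconj (a * b))"
  defines "\<phi> \<equiv> \<lambda>x. herm3 p q r (hRe (x $ p $ p)) (hRe (x $ q $ q)) (hRe (x $ r $ r))
     (A (x $ p $ q)) (B (x $ q $ r)) (C (x $ r $ p))"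
  shows "jordan_aut \<phi>"
proof -
  have \<phi>_herm3: "\<phi> (herm3 p q r \<alpha> \<beta> \<gamma> a b c) = herm3 p q r \<alpha> \<beta> \<gamma> (A a) (B b) (C c)" for \<alpha> \<beta> \<gamma> a b c
    by (simp only: \<phi>_def herm3_entries)
  note lin = linear_add[OF assms(1)] linear_add[OF assms(2)] linear_add[OF assms(3)]
    linear_scale[OF assms(1)] linear_scale[OF assms(2)] linear_scale[OF assms(3)]
  define \<psi> where "\<psi> \<equiv> \<lambda>x. herm3 p q r (hRe (x $ p $ p)) (hRe (x $ q $ q)) (hRe (x $ r $ r))
     (A' (x $ p $ q)) (B' (x $ q $ r)) (C' (x $ r $ p))"
  have \<psi>_herm3: "\<psi> (herm3 p q r \<alpha> \<beta> \<gamma> a b c) = herm3 p q r \<alpha> \<beta> \<gamma> (A' a) (B' b) (C' c)" for \<alpha> \<beta> \<gamma> a b c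
    by (simp only: \<psi>_def herm3_entries)
  show "jordan_aut \<phi>"
  proof (rule jordan_autI[where \<psi> = \<psi>])
    show "linear \<phi>"
      using distinct_pqr by (simp add: linear_iff \<phi>_def vec_eq_iff all_pqr herm3_def lin hRe_add hRe_scaleR
          hconj_add hconj_scaleR scaleR_add_left)
    show "\<phi> x \<in> Herm" "\<psi> x \<in> Herm" for x by (simp_all add: \<phi>_def \<psi>_def herm3_in_Herm)
    fix x :: "('h, 'n) sqmat" assume x: "x \<in> Herm"
    show "\<psi> (\<phi> x) = x" "\<phi> (\<psi> x) = x"
      by (subst (1 2) Herm_eq_herm3[OF x], simp only: \<phi>_herm3 \<psi>_herm3 inv)+
    fix y :: "('h, 'n) sqmat" assume y: "y \<in> Herm"
    show "\<phi> (jmul x y) = jmul (\<phi> x) (\<phi> y)"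
      by (subst (1 2) Herm_eq_herm3[OF x], subst (1 2) Herm_eq_herm3[OF y])
        (simp only: \<phi>_herm3 jmul_herm3 iso lin tri hconj_add)
  qed
qed

text \<open>For the unit vector \<open>w = z / |z|\<close> the triple consists of left multiplication by the conjugate of \<open>w\<close>,
  right multiplication by it, and \<open>c \<mapsto> w c w\<close>. The three compatibility conditions are the left, right and
  middle Moufang identities.\<close>

lemma jordan_aut_rotating_entry_to_real:
  fixes z :: "'h::hurwitz_algebra"
  assumes "z \<noteq> 0"
  obtains \<phi> :: "('h, 'n) sqmat \<Rightarrow> ('h, 'n) sqmat" where "jordan_aut \<phi>"
    "\<And>\<alpha> \<beta> \<gamma>. \<phi> (herm3 p q r \<alpha> \<beta> \<gamma> 0 0 0) = herm3 p q r \<alpha> \<beta> \<gamma> 0 0 0"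
    "\<And>\<alpha> \<beta> \<gamma>. \<phi> (herm3 p q r \<alpha> \<beta> \<gamma> z 0 0) = herm3 p q r \<alpha> \<beta> \<gamma> (scaleR (norm z) 1) 0 0"
proof -
  define w where "w = scaleR (1 / norm z) z"
  have w: "norm w = 1" using assms by (simp add: w_def)
  have cancel: "hconj w * (w * x) = x" "w * (hconj w * x) = x" "(x * w) * hconj w = x" "(x * hconj w) * w = x" for x
    by (simp_all add: hconj_mult_cancel mult_hconj_cancel_left mult_hconj_cancel_right hconj_mult_cancel_right w)
  have m1: "(w * (c * w)) * (hconj w * a) = w * (c * a)" for a c
    by (simp add: moufang_left cancel)
  have m2: "(b * hconj w) * (w * (c * w)) = (b * c) * w" for b c
    by (simp add: moufang_right cancel)
  \<comment> \<open>The middle identity comes from the other two by writing \<open>b * hconj w\<close> in the form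
    \<open>hconj w * (s * hconj w)\<close> with \<open>s = w * b\<close>.\<close>
  have m3: "(hconj w * a) * (b * hconj w) = hconj w * ((a * b) * hconj w)" for a b
  proof -
    have "b * hconj w = hconj w * ((w * b) * hconj w)" by (simp add: cancel flip: flexible)
    then have "(hconj w * a) * (b * hconj w) = ((hconj w * (a * hconj w)) * (w * b)) * hconj w"
      by (simp only: moufang_right flexible)
    also have "\<dots> = hconj w * ((a * b) * hconj w)"
      by (simp only: moufang_left cancel flexible)
    finally show ?thesis .
  qed
  note tri = jordan_aut_triality[where A = "\<lambda>x. hconj w * x" and B = "\<lambda>x. x * hconj w" and C = "\<lambda>x. w * (x * w)"
      and A' = "\<lambda>x. w * x" and B' = "\<lambda>x. x * w" and C' = "\<lambda>x. hconj w * (x * hconj w)"]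
  have lin: "linear (\<lambda>x. hconj w * x)" "linear (\<lambda>x. x * hconj w)" "linear (\<lambda>x. w * (x * w))"
    by (simp_all add: linear_iff hmult_add_left hmult_add_right hmult_scaleR_left hmult_scaleR_right)
  have iso: "inner (hconj w * x) (hconj w * y) = inner x y" "inner (x * hconj w) (y * hconj w) = inner x y"
    "inner (w * (x * w)) (w * (y * w)) = inner x y" for x y
    by (simp_all add: inner_mult_left inner_mult_right norm_hconj w)
  have inv: "hconj w * ((w * (x * w)) * hconj w) = x" "w * ((hconj w * (x * hconj w)) * w) = x" for x
    by (simp_all add: cancel flip: flexible)
  have c3: "hconj ((hconj w * a) * (b * hconj w)) = w * (hconj (a * b) * w)" 
    "hconj ((b * hconj w) * (w * (c * w))) = hconj w * hconj (b * c)"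
    "hconj ((w * (c * w)) * (hconj w * a)) = hconj (c * a) * hconj w" for a b c
    unfolding m1 m2 m3 by (simp_all add: hconj_mult hconj_hconj flexible)
  note aut = tri[OF lin iso cancel(2) cancel(4) inv(1) cancel(1) cancel(3) inv(2) c3(2) c3(3) c3(1)]
  show thesis
    by (rule that[OF aut]) (simp_all add: herm3_entries hmult_zero_left hmult_zero_right w_def hconj_scaleR
        hmult_scaleR_left hconj_mult_self power2_eq_square)
qed

end

section \<open>Commutators with a real diagonal matrix\<close>

definition real_diag :: "('n \<Rightarrow> real) \<Rightarrow> ('h::conj_algebra, 'n::finite) sqmat" where
  "real_diag d = diag_mat (\<lambda>i. scaleR (d i) 1)"

lemma diagonal_Herm_real_diag:
  fixes x :: "('h::hurwitz_algebra, 'n::finite) sqmat"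
  assumes "diagonal x" "x \<in> Herm"
  obtains d where "x = real_diag d"
proof
  show "x = real_diag (\<lambda>i. hRe (x $ i $ i))"
    using assms Herm_diagonal_entry[OF assms(2)]
    by (auto simp: vec_eq_iff real_diag_def diag_mat_def diagonal_def)
qed

lemma real_diag_nth: "real_diag d $ i $ j = (if i = j then scaleR (d i) 1 else 0)"
  by (simp add: real_diag_def diag_mat_def)

lemma mmul_real_diag_left: "mmul (real_diag d) y $ i $ j = scaleR (d i) (y $ i $ j :: 'h::hurwitz_algebra)"
  by (simp add: real_diag_def mmul_diag_mat_left hmult_scaleR_left hmult_one_left)

lemma mmul_real_diag_right: "mmul y (real_diag d) $ i $ j = scaleR (d j) (y $ i $ j :: 'h::hurwitz_algebra)"
  by (simp add: real_diag_def mmul_diag_mat_right hmult_scaleR_right hmult_one_right)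

lemma norm_sq_real_diag:
  "norm_sq (real_diag d :: ('h::hurwitz_algebra, 'n::finite) sqmat) = (\<Sum>i\<in>UNIV. (d i)\<^sup>2)"
proof -
  have "(norm (real_diag d $ i $ j :: 'h))\<^sup>2 = (if j = i then (d i)\<^sup>2 else 0)" for i j :: 'n
    by (simp add: real_diag_nth norm_one_hurwitz)
  then show ?thesis by (simp add: norm_sq_eq_sum)
qed

lemma norm_sq_comm_real_diag:
  "norm_sq (comm (real_diag d) y) = (\<Sum>i\<in>UNIV. \<Sum>j\<in>UNIV. (d i - d j)\<^sup>2 * (norm (y $ i $ j :: 'h::hurwitz_algebra))\<^sup>2)"
proof -
  have "comm (real_diag d) y $ i $ j = scaleR (d i - d j) (y $ i $ j)" for i j
    by (simp add: comm_def mmul_real_diag_left mmul_real_diag_right scaleR_diff_left)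
  then show ?thesis by (simp add: norm_sq_eq_sum power_mult_distrib)
qed

text \<open>The diagonal terms \<open>i = j\<close> on the right are \<open>2 |x|\<^sup>2 |y i i|\<^sup>2\<close>, so for nonzero \<open>x\<close> equality also
  forces the diagonal of \<open>y\<close> to vanish.\<close>

lemma comm_deficit_real_diag:
  fixes y :: "('h::hurwitz_algebra, 'n::finite) sqmat"
  shows "2 * norm_sq (real_diag d :: ('h, 'n) sqmat) * norm_sq y - norm_sq (comm (real_diag d) y)
    = (\<Sum>i\<in>UNIV. \<Sum>j\<in>UNIV. (2 * (\<Sum>k\<in>UNIV. (d k)\<^sup>2) - (d i - d j)\<^sup>2) * (norm (y $ i $ j))\<^sup>2)"
  unfolding norm_sq_comm_real_diag norm_sq_real_diag norm_sq_eq_sum[of y]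
  by (simp add: left_diff_distrib sum_subtractf sum_distrib_left)

text \<open>The parallelogram law for \<open>d i\<close> and \<open>d j\<close>. The right-hand side shows both that the left-hand side is
  nonnegative and when it vanishes.\<close>

lemma sum_squares_pair:
  fixes d :: "'n::finite \<Rightarrow> real"
  assumes "i \<noteq> j"
  shows "2 * (\<Sum>k\<in>UNIV. (d k)\<^sup>2) - (d i - d j)\<^sup>2 = (d i + d j)\<^sup>2 + 2 * (\<Sum>k\<in>UNIV - {i} - {j}. (d k)\<^sup>2)"
proof -
  have "(\<Sum>k\<in>UNIV. (d k)\<^sup>2) = (d i)\<^sup>2 + (d j)\<^sup>2 + (\<Sum>k\<in>UNIV - {i} - {j}. (d k)\<^sup>2)"
    using assms by (simp add: sum.remove[of UNIV i] sum.remove[of "UNIV - {i}" j])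
  then show ?thesis by (simp add: power2_sum power2_diff)
qed

lemma sum_squares_ge_diff:
  fixes d :: "'n::finite \<Rightarrow> real"
  shows "0 \<le> 2 * (\<Sum>k\<in>UNIV. (d k)\<^sup>2) - (d i - d j)\<^sup>2"
proof (cases "i = j")
  case False
  show ?thesis unfolding sum_squares_pair[OF False] by (simp add: sum_nonneg)
qed (simp add: sum_nonneg)

lemma sum_squares_eq_diff:
  fixes d :: "'n::finite \<Rightarrow> real"
  assumes "i \<noteq> j" "2 * (\<Sum>k\<in>UNIV. (d k)\<^sup>2) - (d i - d j)\<^sup>2 = 0"
  shows "d j = - d i" "k \<noteq> i \<Longrightarrow> k \<noteq> j \<Longrightarrow> d k = 0"
proof -
  have z: "(d i + d j)\<^sup>2 + 2 * (\<Sum>k\<in>UNIV - {i} - {j}. (d k)\<^sup>2) = 0"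
    using assms sum_squares_pair by metis
  have n: "0 \<le> (\<Sum>k\<in>UNIV - {i} - {j}. (d k)\<^sup>2)" by (simp add: sum_nonneg)
  have "(d i + d j)\<^sup>2 = 0" using z n zero_le_power2[of "d i + d j"] by linarith
  then show "d j = - d i" by simp
  have "(\<Sum>k\<in>UNIV - {i} - {j}. (d k)\<^sup>2) = 0" using z n zero_le_power2[of "d i + d j"] by linarith
  then show "k \<noteq> i \<Longrightarrow> k \<noteq> j \<Longrightarrow> d k = 0" by (simp add: sum_nonneg_eq_0_iff)
qed

lemma norm_sq_comm_le_diagonal:
  fixes x y :: "('h::hurwitz_algebra, 'n::finite) sqmat"
  assumes "x \<in> Herm" "diagonal x"
  shows "norm_sq (comm x y) \<le> 2 * norm_sq x * norm_sq y"
proof -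
  obtain d where x: "x = real_diag d" using diagonal_Herm_real_diag assms by blast
  have "0 \<le> 2 * norm_sq x * norm_sq y - norm_sq (comm x y)"
    unfolding x comm_deficit_real_diag by (intro sum_nonneg mult_nonneg_nonneg sum_squares_ge_diff) simp
  then show ?thesis by simp
qed

definition off_diag :: "'n \<Rightarrow> 'n \<Rightarrow> 'h \<Rightarrow> ('h::conj_algebra, 'n::finite) sqmat" where
  "off_diag i j z = (\<chi> k l. if k = i \<and> l = j then z else if k = j \<and> l = i then hconj z else 0)"

lemma norm_sq_eq_0: "norm_sq x = 0 \<longleftrightarrow> x = (0 :: ('h::hurwitz_algebra, 'n::finite) sqmat)"
  by (simp add: norm_sq_eq_norm)

lemma outer_eq_diagonal_shape:
  fixes x y :: "('h::hurwitz_algebra, 'n::finite) sqmat"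
  assumes "x \<in> Herm" "y \<in> Herm" "diagonal x" "outer_eq x y" "x \<noteq> 0" "y \<noteq> 0"
  obtains i j a z where "i \<noteq> j" "z \<noteq> 0" "x = scaleR a (mat_unit i i - mat_unit j j)" "y = off_diag i j z"
proof -
  obtain d where x: "x = real_diag d" using diagonal_Herm_real_diag assms by blast
  let ?D = "\<Sum>k\<in>UNIV. (d k)\<^sup>2"
  have D: "?D \<noteq> 0" using \<open>x \<noteq> 0\<close> norm_sq_eq_0[of x] by (simp add: x norm_sq_real_diag)
  have "(\<Sum>i\<in>UNIV. \<Sum>j\<in>UNIV. (2 * ?D - (d i - d j)\<^sup>2) * (norm (y $ i $ j))\<^sup>2) = 0"
    using \<open>outer_eq x y\<close> unfolding comm_deficit_real_diag[symmetric] by (simp add: outer_eq_def x)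
  moreover have pos: "0 \<le> (2 * ?D - (d i - d j)\<^sup>2) * (norm (y $ i $ j))\<^sup>2" for i j
    by (intro mult_nonneg_nonneg sum_squares_ge_diff) simp
  ultimately have "(2 * ?D - (d i - d j)\<^sup>2) * (norm (y $ i $ j))\<^sup>2 = 0" for i j
    by (simp add: sum_nonneg_eq_0_iff sum_nonneg)
  then have tight: "2 * ?D - (d i - d j)\<^sup>2 = 0" if "y $ i $ j \<noteq> 0" for i j
    using that by (metis mult_eq_0_iff norm_eq_zero power_eq_0_iff)
  have off: "i \<noteq> j" if "y $ i $ j \<noteq> 0" for i j
    using tight[OF that] D by auto
  obtain i j where ij: "y $ i $ j \<noteq> 0" using \<open>y \<noteq> 0\<close> by (auto simp: vec_eq_iff)
  have "i \<noteq> j" by (rule off[OF ij])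
  note d = sum_squares_eq_diff[OF this tight[OF ij]]
  have di: "d i \<noteq> 0"
  proof
    assume "d i = 0"
    then have "d k = 0" for k using d by (cases "k = i \<or> k = j") auto
    then show False using D by simp
  qed
  have supp: "k = i \<and> l = j \<or> k = j \<and> l = i" if "y $ k $ l \<noteq> 0" for k l
  proof -
    have "d l = - d k" "k \<noteq> l" using sum_squares_eq_diff(1)[OF off tight] off that by blast+
    moreover have "d k \<noteq> 0 \<or> d l \<noteq> 0"
      using sum_squares_eq_diff(2)[OF off tight, OF that that, of i] di by metis
    ultimately show ?thesis using d(2)[of k] d(2)[of l] by force
  qed
  have "x = scaleR (d i) (mat_unit i i - mat_unit j j)"
    using \<open>i \<noteq> j\<close> d by (auto simp: x vec_eq_iff real_diag_nth mat_unit_def)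
  moreover have "y = off_diag i j (y $ i $ j)"
    using supp HermD[OF \<open>y \<in> Herm\<close>] by (auto simp: vec_eq_iff off_diag_def)
  ultimately show thesis using that \<open>i \<noteq> j\<close> ij by blast
qed

section \<open>Moving to the standard pair\<close>

lemma sim_equiv_jordan_aut:
  fixes x y :: "('h::hurwitz_algebra, 'n::{finite,linorder}) sqmat"
  assumes \<phi>: "jordan_aut \<phi>" and xy: "x \<in> Herm" "y \<in> Herm"
  shows "sim_equiv (\<phi> x) (\<phi> y) \<longleftrightarrow> sim_equiv x y"
proof
  assume "sim_equiv (\<phi> x) (\<phi> y)"
  then show "sim_equiv x y"
    unfolding sim_equiv_def using jordan_aut_comp[OF \<phi>] by (metis comp_apply)
next
  assume "sim_equiv x y"
  moreover have "inv_into Herm \<phi> (\<phi> x) = x" "inv_into Herm \<phi> (\<phi> y) = y"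
    using \<phi> xy by (auto simp: jordan_aut_def intro: bij_betw_inv_into_left)
  ultimately show "sim_equiv (\<phi> x) (\<phi> y)"
    unfolding sim_equiv_def using jordan_aut_comp[OF jordan_aut_inv[OF \<phi>]] by (metis comp_apply)
qed

lemma permute_mat_unit: "inj \<sigma> \<Longrightarrow> permute_entries \<sigma> (mat_unit (\<sigma> i) (\<sigma> j)) = mat_unit i j"
  by (simp add: permute_entries_def mat_unit_def vec_eq_iff inj_eq)

lemma permute_off_diag: "inj \<sigma> \<Longrightarrow> permute_entries \<sigma> (off_diag (\<sigma> i) (\<sigma> j) z) = off_diag i j z"
  by (simp add: permute_entries_def off_diag_def vec_eq_iff inj_eq)

lemma off_diag_real: "i \<noteq> j \<Longrightarrow> off_diag i j (scaleR b 1) = scaleR b (mat_unit i j + mat_unit j i)"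
  by (auto simp: off_diag_def mat_unit_def vec_eq_iff hconj_scaleR hconj_one)

lemma linear_permute_entries: "linear (permute_entries \<sigma> :: ('h::real_vector, 'n::finite) sqmat \<Rightarrow> _)"
  by (simp add: linear_iff permute_entries_def vec_eq_iff)

lemma bij_mapping_pair:
  assumes "p \<noteq> q" "i \<noteq> j"
  obtains \<sigma> :: "'n \<Rightarrow> 'n" where "bij \<sigma>" "\<sigma> p = i" "\<sigma> q = j"
proof
  let ?t = "Transposition.transpose p i"
  let ?s = "Transposition.transpose (?t q) j"
  show "bij (?s \<circ> ?t)" by (intro bij_comp bij_swap_iff[THEN iffD2] bij_transpose)
  have "?t q \<noteq> i" using assms by (auto simp: Transposition.transpose_def)
  then show "(?s \<circ> ?t) p = i" "(?s \<circ> ?t) q = j"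
    using assms by (simp_all add: Transposition.transpose_def)
qed

lemma first_ix_neq_last_ix:
  fixes i j :: "'n::{finite,linorder}"
  assumes "i \<noteq> j"
  shows "(first_ix :: 'n) \<noteq> last_ix"
  using assms unfolding first_ix_def last_ix_def
  by (metis Max_ge Min_le UNIV_I antisym finite order_trans)

text \<open>A permutation moves the places \<open>i\<close>, \<open>j\<close> to \<open>p\<close>, \<open>q\<close>, where \<open>\<phi>\<close> makes the entry real, and a
  second one moves them on to the first and last index. Thus a suitable \<open>\<phi>\<close> is needed for only one pair
  of places, which may be chosen at will.\<close>

lemma sim_equiv_off_diag:
  fixes p q i j :: "'n::{finite,linorder}" and z :: "'h::hurwitz_algebra"
  assumes "p \<noteq> q" "i \<noteq> j"
    and \<phi>: "jordan_aut \<phi>" "\<And>a. \<phi> (scaleR a (mat_unit p p - mat_unit q q)) = scaleR a (mat_unit p p - mat_unit q q)"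
      "\<phi> (off_diag p q z) = off_diag p q (scaleR b 1)"
  shows "sim_equiv (scaleR a (mat_unit i i - mat_unit j j) :: ('h, 'n) sqmat) (off_diag i j z)"
proof -
  obtain \<sigma> where \<sigma>: "bij \<sigma>" "\<sigma> p = i" "\<sigma> q = j" by (rule bij_mapping_pair[OF assms(1,2)]) blast
  obtain \<tau> :: "'n \<Rightarrow> 'n" where \<tau>: "bij \<tau>" "\<tau> first_ix = p" "\<tau> last_ix = q"
    by (rule bij_mapping_pair[OF first_ix_neq_last_ix[OF assms(1)] assms(1)]) blast
  let ?\<psi> = "permute_entries \<tau> \<circ> (\<phi> \<circ> permute_entries \<sigma>)"
  note lin = linear_scale[OF linear_permute_entries] linear_diff[OF linear_permute_entries]
  have mu: "permute_entries \<sigma> (mat_unit i i) = mat_unit p p" "permute_entries \<sigma> (mat_unit j j) = mat_unit q q"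
    "permute_entries \<tau> (mat_unit p p) = mat_unit first_ix first_ix"
    "permute_entries \<tau> (mat_unit q q) = mat_unit last_ix last_ix"
    using permute_mat_unit[OF bij_is_inj[OF \<sigma>(1)], of p p] permute_mat_unit[OF bij_is_inj[OF \<sigma>(1)], of q q]
      permute_mat_unit[OF bij_is_inj[OF \<tau>(1)], of first_ix first_ix]
      permute_mat_unit[OF bij_is_inj[OF \<tau>(1)], of last_ix last_ix]
    by (simp_all add: \<sigma>(2,3) \<tau>(2,3))
  have "jordan_aut ?\<psi>"
    by (intro jordan_aut_comp jordan_aut_permute_entries \<sigma> \<tau> \<phi>)
  moreover have "?\<psi> (scaleR a (mat_unit i i - mat_unit j j)) = scaleR a (mat_unit first_ix first_ix - mat_unit last_ix last_ix)"
    by (simp add: lin mu \<phi>(2))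
  moreover have "?\<psi> (off_diag i j z) = scaleR b (mat_unit first_ix last_ix + mat_unit last_ix first_ix)"
    using permute_off_diag[OF bij_is_inj[OF \<sigma>(1)], of p q z] permute_off_diag[OF bij_is_inj[OF \<tau>(1)], of first_ix last_ix "scaleR b 1"]
    by (simp add: \<sigma> \<tau> \<phi>(3) off_diag_real[OF first_ix_neq_last_ix[OF assms(1)]])
  ultimately show ?thesis unfolding sim_equiv_def by blast
qed

lemma sim_equiv_off_diag_assoc:
  fixes i j :: "'n::{finite,linorder}" and z :: "'h::assoc_hurwitz"
  assumes "i \<noteq> j" "z \<noteq> 0"
  shows "sim_equiv (scaleR a (mat_unit i i - mat_unit j j) :: ('h, 'n) sqmat) (off_diag i j z)"
proof -
  obtain u :: "('h, 'n) sqmat" where u: "unitary u"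
    "\<And>x. x $ i $ j = z \<Longrightarrow> conjugate_by u x $ i $ j = scaleR (norm z) 1"
    and u': "\<And>x k l r. x $ k $ l = scaleR r 1 \<Longrightarrow> k = l \<or> r = 0 \<Longrightarrow> conjugate_by u x $ k $ l = scaleR r 1"
    by (rule unitary_phase[OF assms]) blast
  show ?thesis
  proof (rule sim_equiv_off_diag[OF assms(1) assms(1) jordan_aut_conjugate_by[OF u(1)]])
    show "conjugate_by u (scaleR a (mat_unit i i - mat_unit j j)) = scaleR a (mat_unit i i - mat_unit j j)" for a
    proof -
      let ?x = "scaleR a (mat_unit i i - mat_unit j j) :: ('h, 'n) sqmat"
      have "?x $ k $ l = scaleR (if k = l then (if k = i then a else if k = j then - a else 0) else 0) 1" for k l
        using assms(1) by (simp add: mat_unit_def)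
      from u'[OF this] this show ?thesis by (simp add: vec_eq_iff)
    qed
    let ?y = "off_diag i j z :: ('h, 'n) sqmat"
    let ?w = "conjugate_by u ?y"
    have "?w \<in> Herm"
      using assms(1) by (intro Herm_conjugate_by) (auto simp: Herm_iff off_diag_def hconj_hconj hconj_zero)
    moreover have ij: "?w $ i $ j = scaleR (norm z) 1" by (rule u(2)) (simp add: off_diag_def)
    ultimately have ji: "?w $ j $ i = scaleR (norm z) 1"
      using HermD[of ?w i j] by (simp add: hconj_scaleR hconj_one)
    have "?w $ k $ l = scaleR 0 1" if "\<not> (k = i \<and> l = j)" "\<not> (k = j \<and> l = i)" for k l
      by (rule u') (use that in \<open>auto simp: off_diag_def\<close>)
    then show "?w = off_diag i j (scaleR (norm z) 1)"
      using ij ji by (auto simp: vec_eq_iff off_diag_def hconj_scaleR hconj_one)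
  qed
qed

lemma (in three_indices) off_diag_eq_herm3: "off_diag p q z = herm3 p q r 0 0 0 (z :: 'h::hurwitz_algebra) 0 0"
  using distinct_pqr by (simp add: vec_eq_iff all_pqr off_diag_def herm3_def hconj_zero)

lemma (in three_indices) mat_unit_diff_eq_herm3:
  "scaleR a (mat_unit p p - mat_unit q q) = herm3 p q r a (- a) 0 (0 :: 'h::hurwitz_algebra) 0 0"
  using distinct_pqr by (simp add: vec_eq_iff all_pqr mat_unit_def herm3_def hconj_zero)

lemma sim_equiv_off_diag_3:
  fixes i j :: 3 and z :: "'h::hurwitz_algebra"
  assumes "i \<noteq> j" "z \<noteq> 0"
  shows "sim_equiv (scaleR a (mat_unit i i - mat_unit j j) :: ('h, 3) sqmat) (off_diag i j z)"
proof -
  interpret three_indices 1 2 "3 :: 3"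
  proof
    show "UNIV = {1, 2, 3::3}" by (rule UNIV_3)
    show "(1::3) \<noteq> 2" "(2::3) \<noteq> 3" "(1::3) \<noteq> 3" by simp_all
  qed
  obtain \<phi> :: "('h, 3) sqmat \<Rightarrow> ('h, 3) sqmat" where \<phi>: "jordan_aut \<phi>"
    "\<And>\<alpha> \<beta> \<gamma>. \<phi> (herm3 1 2 3 \<alpha> \<beta> \<gamma> 0 0 0) = herm3 1 2 3 \<alpha> \<beta> \<gamma> 0 0 0"
    "\<And>\<alpha> \<beta> \<gamma>. \<phi> (herm3 1 2 3 \<alpha> \<beta> \<gamma> z 0 0) = herm3 1 2 3 \<alpha> \<beta> \<gamma> (scaleR (norm z) 1) 0 0"
    by (rule jordan_aut_rotating_entry_to_real[OF assms(2)]) blast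
  show ?thesis
  proof (rule sim_equiv_off_diag[OF distinct_pqr(1) assms(1) \<phi>(1)])
    show "\<phi> (scaleR a (mat_unit 1 1 - mat_unit 2 2)) = scaleR a (mat_unit 1 1 - mat_unit 2 2)" for a
      unfolding mat_unit_diff_eq_herm3 by (rule \<phi>(2))
    show "\<phi> (off_diag 1 2 z) = off_diag 1 2 (scaleR (norm z) 1)"
      unfolding off_diag_eq_herm3 by (rule \<phi>(3))
  qed
qed

section \<open>The standard pair attains the bound\<close>

text \<open>The hypothesis \<open>prim\<close> says that \<open>z \<mapsto> q z q\<close>, written with the Jordan product only, has
  image in the line of \<open>q\<close>. For \<open>z = e\<^sub>k\<^sub>k\<close> the diagonal entries of \<open>q z q\<close> are \<open>|q i k|\<^sup>2\<close>,
  and they equal \<open>c q i i\<close> for some \<open>c\<close>. The entry \<open>i = k\<close> gives \<open>c = q k k\<close> if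
  \<open>q k k \<noteq> 0\<close>. Summing over \<open>i\<close> and using \<open>q q = q\<close> then gives \<open>c tr q = q k k\<close>.\<close>

lemma trace_primitive_idempotent:
  fixes q :: "('h::hurwitz_algebra, 'n::finite) sqmat"
  assumes q: "q \<in> Herm" "jmul q q = q" "q \<noteq> 0"
    and prim: "\<And>z. z \<in> Herm \<Longrightarrow> \<exists>c. scaleR 2 (jmul q (jmul q z)) - jmul q z = scaleR c q"
  shows "(\<Sum>i\<in>UNIV. hRe (q $ i $ i)) = 1"
proof -
  have qq: "mmul q q = q" using q(2) by (simp add: jmul_def scaleR_2[symmetric])
  have sq: "q $ i $ k * q $ k $ i = scaleR ((norm (q $ i $ k))\<^sup>2) 1" for i k
    using mult_hconj_self[of "q $ i $ k"] HermD[OF q(1), of i k] by metis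
  have row: "(\<Sum>i\<in>UNIV. (norm (q $ i $ k))\<^sup>2) = hRe (q $ k $ k)" for k
  proof -
    have "hRe (q $ k $ k) = (\<Sum>i\<in>UNIV. hRe (q $ k $ i * q $ i $ k))"
      by (subst qq[symmetric]) (simp add: mmul_def hRe_sum)
    then show ?thesis by (simp add: sq hRe_scaleR hRe_one Herm_norm_sym[OF q(1), of _ k])
  qed
  have diag: "(norm (q $ i $ i))\<^sup>2 = (hRe (q $ i $ i))\<^sup>2" for i
    by (subst Herm_diagonal_entry[OF q(1)]) (simp add: norm_one_hurwitz)
  have ex: "\<exists>c. \<forall>i. (norm (q $ i $ k))\<^sup>2 = c * hRe (q $ i $ i)" for k
  proof -
    let ?E = "mat_unit k k :: ('h, 'n) sqmat"
    obtain c where c: "scaleR 2 (jmul q (jmul q ?E)) - jmul q ?E = scaleR c q"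
      using prim[OF Herm_mat_unit_diag] by blast
    have qE: "mmul q ?E $ i $ j = (if j = k then q $ i $ k else 0)" for i j
      by (simp add: mmul_def mat_unit_def if_distrib[of "\<lambda>a. _ * a"] hmult_one_right hmult_zero_right cong: if_cong)
    have Eq: "mmul ?E q $ i $ j = (if i = k then q $ k $ j else 0)" for i j
      by (simp add: mmul_def mat_unit_def if_distrib[of "\<lambda>a. a * _"] hmult_one_left hmult_zero_left cong: if_cong)
    have m1: "mmul q (mmul q ?E) $ i $ i = (if i = k then q $ k $ k else 0)" for i
      by (simp only: qE mmul_def[of q "mmul q ?E"] vec_lambda_beta)
        (use qq in \<open>simp add: mmul_def vec_eq_iff hmult_zero_right\<close>)
    have m2: "mmul (mmul ?E q) q $ i $ i = (if i = k then q $ k $ k else 0)" for i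
      by (simp only: Eq mmul_def[of "mmul ?E q" q] vec_lambda_beta)
        (use qq in \<open>simp add: mmul_def vec_eq_iff hmult_zero_left\<close>)
    have m3: "mmul q (mmul ?E q) $ i $ i = q $ i $ k * q $ k $ i" for i
      by (simp only: Eq mmul_def[of q "mmul ?E q"] vec_lambda_beta)
        (simp add: if_distrib[of "\<lambda>a. _ * a"] hmult_zero_right cong: if_cong)
    have m4: "mmul (mmul q ?E) q $ i $ i = q $ i $ k * q $ k $ i" for i
      by (simp only: qE mmul_def[of "mmul q ?E" q] vec_lambda_beta)
        (simp add: if_distrib[of "\<lambda>a. a * _"] hmult_zero_left cong: if_cong)
    have half: "scaleR (1/2) (a + b) + scaleR (1/2) (b + a) - a = b" for a b :: 'h
      by (simp add: add.commute[of b a] flip: scaleR_add_left)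
    have "(scaleR 2 (jmul q (jmul q ?E)) - jmul q ?E) $ i $ i = q $ i $ k * q $ k $ i" for i
      by (simp add: jmul_def mmul.add_left mmul.add_right mmul.scaleR_left mmul.scaleR_right
          m1 m2 m3 m4 qE Eq half flip: scaleR_2)
    then have "scaleR c q $ i $ i = scaleR ((norm (q $ i $ k))\<^sup>2) 1" for i
      by (simp only: c sq)
    from arg_cong[OF this, of hRe] have "(norm (q $ i $ k))\<^sup>2 = c * hRe (q $ i $ i)" for i
      by (simp add: hRe_scaleR hRe_one)
    then show ?thesis by blast
  qed
  obtain l k where "q $ l $ k \<noteq> 0" using \<open>q \<noteq> 0\<close> by (auto simp: vec_eq_iff)
  then have "0 < (norm (q $ l $ k))\<^sup>2" by simp
  also have "\<dots> \<le> (\<Sum>i\<in>UNIV. (norm (q $ i $ k))\<^sup>2)" by (rule member_le_sum) auto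
  finally have qk: "hRe (q $ k $ k) > 0" by (simp add: row)
  obtain c where c: "\<And>i. (norm (q $ i $ k))\<^sup>2 = c * hRe (q $ i $ i)" using ex[of k] by blast
  have "c = hRe (q $ k $ k)" using c[of k] diag[of k] qk by (simp add: power2_eq_square)
  moreover have "c * (\<Sum>i\<in>UNIV. hRe (q $ i $ i)) = hRe (q $ k $ k)"
    using row[of k] by (simp add: c sum_distrib_left)
  ultimately show ?thesis using qk by simp
qed

lemma mmul_mat_unit:
  "mmul (mat_unit i j) (mat_unit k l :: ('h::hurwitz_algebra, 'n::finite) sqmat) = (if j = k then mat_unit i l else 0)"
proof -
  have "(\<Sum>p\<in>UNIV. (if a = i \<and> p = j then 1 else 0) * (if p = k \<and> b = l then 1 else (0::'h)))
     = (\<Sum>p\<in>UNIV. if p = j then (if a = i \<and> j = k \<and> b = l then 1 else 0) else 0)" for a b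
    by (rule sum.cong) (auto simp: hmult_one_left hmult_zero_left hmult_zero_right)
  then show ?thesis by (simp add: mmul_def mat_unit_def vec_eq_iff)
qed

lemma mat_unit_diag_primitive:
  fixes z :: "('h::hurwitz_algebra, 'n::finite) sqmat" and p :: 'n
  assumes "z \<in> Herm"
  defines "e \<equiv> mat_unit p p"
  shows "scaleR 2 (jmul e (jmul e z)) - jmul e z = scaleR (hRe (z $ p $ p)) e"
proof -
  have l: "mmul e y $ i $ j = (if i = p then y $ p $ j else 0)" for i j and y :: "('h, 'n) sqmat"
    by (simp add: e_def mmul_def mat_unit_def if_distrib[of "\<lambda>a. a * _"] hmult_one_left hmult_zero_left cong: if_cong)
  have r: "mmul y e $ i $ j = (if j = p then y $ i $ p else 0)" for i j and y :: "('h, 'n) sqmat"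
    by (simp add: e_def mmul_def mat_unit_def if_distrib[of "\<lambda>a. _ * a"] hmult_one_right hmult_zero_right cong: if_cong)
  have "(scaleR 2 (jmul e (jmul e z)) - jmul e z) $ i $ j = (if i = p \<and> j = p then z $ p $ p else 0)" for i j
    by (simp add: jmul_def l r flip: scaleR_2) (simp add: scaleR_2)
  then show ?thesis
    using Herm_diagonal_entry[OF assms(1), of p, symmetric] by (simp add: vec_eq_iff e_def mat_unit_def)
qed

lemma jmul_mat_unit_diag: "jmul (mat_unit p p) (mat_unit p p) = (mat_unit p p :: ('h::hurwitz_algebra, 'n::finite) sqmat)"
  by (simp add: jmul_def mmul_mat_unit flip: scaleR_2)

text \<open>Being an idempotent that is primitive in the above sense is a Jordan-theoretic property, so automorphisms
  preserve it.\<close>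

lemma trace_jordan_aut_mat_unit:
  fixes \<psi> :: "('h::hurwitz_algebra, 'n::finite) sqmat \<Rightarrow> ('h, 'n) sqmat"
  assumes \<psi>: "jordan_aut \<psi>"
  shows "(\<Sum>i\<in>UNIV. hRe (\<psi> (mat_unit p p) $ i $ i)) = 1"
proof (rule trace_primitive_idempotent)
  let ?e = "mat_unit p p :: ('h, 'n) sqmat"
  have e: "?e \<in> Herm" by (rule Herm_mat_unit_diag)
  have bij: "bij_betw \<psi> Herm Herm" 
    and add: "\<And>x y. x \<in> Herm \<Longrightarrow> y \<in> Herm \<Longrightarrow> \<psi> (x + y) = \<psi> x + \<psi> y"
    and scale: "\<And>x c. x \<in> Herm \<Longrightarrow> \<psi> (scaleR c x) = scaleR c (\<psi> x)"
    and mul: "\<And>x y. x \<in> Herm \<Longrightarrow> y \<in> Herm \<Longrightarrow> \<psi> (jmul x y) = jmul (\<psi> x) (\<psi> y)"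
    using \<psi> by (simp_all add: jordan_aut_def)
  have zero: "0 \<in> (Herm :: ('h, 'n) sqmat set)" "\<psi> 0 = 0"
    using Herm_scaleR[OF e, of 0] scale[OF e, of 0] by simp_all
  show "\<psi> ?e \<in> Herm" using bij e by (auto simp: bij_betw_def)
  show "jmul (\<psi> ?e) (\<psi> ?e) = \<psi> ?e" by (simp add: e jmul_mat_unit_diag flip: mul)
  have "?e $ p $ p \<noteq> 0" by (simp add: mat_unit_def hone_neq_zero)
  then have "?e \<noteq> 0" by (metis zero_index)
  then show "\<psi> ?e \<noteq> 0" using bij e zero by (metis bij_betw_def inj_onD)
  fix z :: "('h, 'n) sqmat" assume "z \<in> Herm"
  then obtain y where y: "y \<in> Herm" "z = \<psi> y" using bij by (auto simp: bij_betw_def)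
  have eq: "scaleR 2 (jmul ?e (jmul ?e y)) = jmul ?e y + scaleR (hRe (y $ p $ p)) ?e"
    using mat_unit_diag_primitive[OF y(1), of p] by (simp add: diff_eq_eq add.commute)
  have "scaleR 2 (jmul (\<psi> ?e) (jmul (\<psi> ?e) z)) = \<psi> (scaleR 2 (jmul ?e (jmul ?e y)))"
    by (simp add: y e mul scale Herm_jmul)
  also have "\<dots> = jmul (\<psi> ?e) z + scaleR (hRe (y $ p $ p)) (\<psi> ?e)"
    unfolding eq by (simp add: y e mul scale add Herm_jmul Herm_scaleR)
  finally show "\<exists>c. scaleR 2 (jmul (\<psi> ?e) (jmul (\<psi> ?e) z)) - jmul (\<psi> ?e) z = scaleR c (\<psi> ?e)"
    by (metis add_diff_cancel_left')
qed

lemma outer_eq_zero: "x = 0 \<or> y = 0 \<Longrightarrow> outer_eq x (y :: ('h::hurwitz_algebra, 'n::finite) sqmat)"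
  by (auto simp: outer_eq_def comm_def norm_sq_eq_norm mmul.zero_left mmul.zero_right)

text \<open>Identities of Jordan products among the standard matrices, pulled back along the automorphism. The trace
  of \<open>p\<close> is the one fact that does not pull back formally.\<close>

lemma standard_pair_relations:
  fixes x y :: "('h::hurwitz_algebra, 'n::{finite,linorder}) sqmat"
  assumes xy: "x \<in> Herm" "y \<in> Herm" "x \<noteq> 0" "y \<noteq> 0" "sim_equiv x y"
  obtains a b p where "a \<noteq> 0" "b \<noteq> 0" "jmul p p = p" "(\<Sum>i\<in>UNIV. hRe (p $ i $ i)) = 2"
    "jmul x x = scaleR (a\<^sup>2) p" "jmul y y = scaleR (b\<^sup>2) p" "jmul x y = 0"
proof -
  let ?E = "mat_unit first_ix first_ix :: ('h, 'n) sqmat"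
  let ?F = "mat_unit last_ix last_ix :: ('h, 'n) sqmat"
  let ?G = "mat_unit first_ix last_ix + mat_unit last_ix first_ix :: ('h, 'n) sqmat"
  obtain \<phi> a b where \<phi>: "jordan_aut \<phi>" "\<phi> x = scaleR a (?E - ?F)" "\<phi> y = scaleR b ?G"
    using xy(5) by (auto simp: sim_equiv_def)
  define \<psi> where "\<psi> = inv_into Herm \<phi>"
  have \<psi>: "jordan_aut \<psi>" unfolding \<psi>_def by (rule jordan_aut_inv[OF \<phi>(1)])
  have inv: "\<psi> (\<phi> z) = z" if "z \<in> Herm" for z
    using \<phi>(1) that by (auto simp: \<psi>_def jordan_aut_def intro: bij_betw_inv_into_left)
  have in_H: "\<phi> z \<in> Herm" if "z \<in> Herm" for z
    using \<phi>(1) that by (auto simp: jordan_aut_def bij_betw_def)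
  have EF: "?E \<in> Herm" "?F \<in> Herm" by (rule Herm_mat_unit_diag)+
  have add: "\<And>x y. x \<in> Herm \<Longrightarrow> y \<in> Herm \<Longrightarrow> \<psi> (x + y) = \<psi> x + \<psi> y"
    and scale: "\<And>x c. x \<in> Herm \<Longrightarrow> \<psi> (scaleR c x) = scaleR c (\<psi> x)"
    and mul: "\<And>x y. x \<in> Herm \<Longrightarrow> y \<in> Herm \<Longrightarrow> \<psi> (jmul x y) = jmul (\<psi> x) (\<psi> y)"
    using \<psi> by (simp_all add: jordan_aut_def)
  have \<psi>0: "\<psi> 0 = 0" using scale[OF EF(1), of 0] by simp
  have "\<phi> x \<noteq> 0" using inv[OF xy(1)] \<psi>0 xy(3) by metis
  then have a: "a \<noteq> 0" and fl: "(first_ix :: 'n) \<noteq> last_ix" unfolding \<phi>(2) by auto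
  have "\<phi> y \<noteq> 0" using inv[OF xy(2)] \<psi>0 xy(4) by metis
  then have b: "b \<noteq> 0" unfolding \<phi>(3) by auto
  define p where "p = \<psi> (?E + ?F)"
  note expand = jmul_def mmul.add_left mmul.add_right mmul.diff_left mmul.diff_right mmul.scaleR_left
    mmul.scaleR_right mmul_mat_unit
  have std: "jmul (?E + ?F) (?E + ?F) = ?E + ?F" "jmul (\<phi> x) (\<phi> x) = scaleR (a\<^sup>2) (?E + ?F)"
    "jmul (\<phi> y) (\<phi> y) = scaleR (b\<^sup>2) (?E + ?F)" "jmul (\<phi> x) (\<phi> y) = 0"
    unfolding \<phi>(2,3) using fl
    by (simp_all add: expand power2_eq_square algebra_simps flip: scaleR_2)
  show thesis
  proof (rule that[of a b p])
    show "a \<noteq> 0" "b \<noteq> 0" by (fact a b)+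
    show "jmul p p = p" by (simp add: p_def std(1) Herm_add EF flip: mul)
    show "(\<Sum>i\<in>UNIV. hRe (p $ i $ i)) = 2"
      by (simp add: p_def add EF hRe_add sum.distrib trace_jordan_aut_mat_unit[OF \<psi>])
    have "jmul x x = \<psi> (jmul (\<phi> x) (\<phi> x))" using xy by (simp add: mul in_H inv)
    then show "jmul x x = scaleR (a\<^sup>2) p" by (simp add: std p_def scale Herm_add EF)
    have "jmul y y = \<psi> (jmul (\<phi> y) (\<phi> y))" using xy by (simp add: mul in_H inv)
    then show "jmul y y = scaleR (b\<^sup>2) p" by (simp add: std p_def scale Herm_add EF)
    have "jmul x y = \<psi> (jmul (\<phi> x) (\<phi> y))" using xy by (simp add: mul in_H inv)
    then show "jmul x y = 0" by (simp add: std \<psi>0)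
  qed
qed

text \<open>For diagonal \<open>x\<close> with entries \<open>d\<close> the relation \<open>x\<^sup>2 = a\<^sup>2 p\<close> makes \<open>p\<close> diagonal with entries
  \<open>e i = d i\<^sup>2 / a\<^sup>2\<close>, which are \<open>0\<close> or \<open>1\<close> by idempotence. The relation \<open>x \<star> y = 0\<close> says that
  \<open>d j = - d i\<close> wherever \<open>y i j \<noteq> 0\<close>, so every commutator entry has norm \<open>2 |d i| |y i j|\<close>, and the row sums
  of \<open>|y i j|\<^sup>2\<close> are the diagonal entries of \<open>y\<^sup>2 = b\<^sup>2 p\<close>.\<close>

lemma outer_eq_if_sim_equiv_diagonal:
  fixes x y :: "('h::hurwitz_algebra, 'n::{finite,linorder}) sqmat"
  assumes xy: "x \<in> Herm" "y \<in> Herm" "diagonal x" "sim_equiv x y"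
  shows "outer_eq x y"
proof (cases "x = 0 \<or> y = 0")
  case False
  then have nz: "x \<noteq> 0" "y \<noteq> 0" by simp_all
  obtain a b p where ab: "a \<noteq> 0" "b \<noteq> 0" and p: "jmul p p = p" "(\<Sum>i\<in>UNIV. hRe (p $ i $ i)) = 2"
    and rel: "jmul x x = scaleR (a\<^sup>2) p" "jmul y y = scaleR (b\<^sup>2) p" "jmul x y = 0"
    by (rule standard_pair_relations[OF xy(1,2) nz xy(4)])
  obtain d where x: "x = real_diag d" using diagonal_Herm_real_diag xy by blast
  define e where "e i = hRe (p $ i $ i)" for i
  have "jmul x x $ i $ j = (if i = j then scaleR ((d i)\<^sup>2) 1 else 0)" for i j
    by (simp add: jmul_def x mmul_real_diag_left real_diag_nth power2_eq_square flip: scaleR_2)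
  then have p_entry: "scaleR (a\<^sup>2) (p $ i $ j) = (if i = j then scaleR ((d i)\<^sup>2) 1 else 0)" for i j
    unfolding rel by (metis vector_scaleR_component)
  have d2: "(d i)\<^sup>2 = a\<^sup>2 * e i" for i
    using arg_cong[OF p_entry[of i i], of hRe] by (simp add: e_def hRe_scaleR hRe_one)
  have "p = real_diag e"
  proof -
    have "p $ i $ j = (if i = j then scaleR (e i) 1 else 0)" for i j
    proof -
      have "scaleR (a\<^sup>2) (p $ i $ j) = scaleR (a\<^sup>2) (if i = j then scaleR (e i) 1 else 0)"
        unfolding p_entry by (simp add: d2)
      then show ?thesis using ab(1) by simp
    qed
    then show ?thesis by (simp add: vec_eq_iff real_diag_nth)
  qed
  have e2: "e i * e i = e i" for i
  proof -
    have "jmul p p $ i $ i = scaleR (e i * e i) 1"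
      unfolding \<open>p = real_diag e\<close>
      by (simp add: jmul_def mmul_real_diag_left real_diag_nth flip: scaleR_2)
    then show ?thesis unfolding p(1) by (metis e_def hRe_one hRe_scaleR mult.right_neutral)
  qed
  have row: "(\<Sum>j\<in>UNIV. (norm (y $ i $ j))\<^sup>2) = b\<^sup>2 * e i" for i
  proof -
    have "y $ i $ j * y $ j $ i = scaleR ((norm (y $ i $ j))\<^sup>2) 1" for j
      using mult_hconj_self[of "y $ i $ j"] HermD[OF xy(2), of i j] by metis
    then have "hRe (jmul y y $ i $ i) = (\<Sum>j\<in>UNIV. (norm (y $ i $ j))\<^sup>2)"
      by (simp add: jmul_def mmul_def hRe_scaleR hRe_add hRe_sum hRe_one)
    then show ?thesis by (simp add: rel e_def hRe_scaleR)
  qed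
  have cross: "(d i - d j)\<^sup>2 * (norm (y $ i $ j))\<^sup>2 = 4 * (d i)\<^sup>2 * (norm (y $ i $ j))\<^sup>2" for i j
  proof (cases "y $ i $ j = 0")
    case False
    have "jmul x y $ i $ j = scaleR ((d i + d j) / 2) (y $ i $ j)"
      by (simp add: jmul_def x mmul_real_diag_left mmul_real_diag_right flip: scaleR_add_left)
    then have "d j = - d i" using False by (simp add: rel)
    then show ?thesis by (simp add: power2_eq_square)
  qed simp
  have "norm_sq (comm x y) = (\<Sum>i\<in>UNIV. 4 * (d i)\<^sup>2 * (\<Sum>j\<in>UNIV. (norm (y $ i $ j))\<^sup>2))"
    unfolding x norm_sq_comm_real_diag cross sum_distrib_left ..
  also have "\<dots> = (\<Sum>i\<in>UNIV. 4 * a\<^sup>2 * b\<^sup>2 * (e i * e i))"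
    unfolding row d2 by (simp add: ac_simps)
  also have "\<dots> = 4 * a\<^sup>2 * b\<^sup>2 * 2"
    unfolding e2 p(2)[folded e_def, symmetric] by (simp add: sum_distrib_left)
  also have "\<dots> = 2 * norm_sq x * norm_sq y"
  proof -
    have "norm_sq x = a\<^sup>2 * 2"
      unfolding x norm_sq_real_diag d2 p(2)[folded e_def, symmetric] by (simp add: sum_distrib_left)
    moreover have "norm_sq y = b\<^sup>2 * 2"
      unfolding norm_sq_eq_sum row p(2)[folded e_def, symmetric] by (simp add: sum_distrib_left)
    ultimately show ?thesis by simp
  qed
  finally show ?thesis by (simp add: outer_eq_def)
qed (rule outer_eq_zero)

section \<open>The two inequalities and their equality cases\<close>

lemma outer_eq_iff_diagonal:
  fixes x y :: "('h::hurwitz_algebra, 'n::{finite,linorder}) sqmat"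
  assumes xy: "x \<in> Herm" "y \<in> Herm" "diagonal x"
    and phase: "\<And>i j a z. i \<noteq> j \<Longrightarrow> z \<noteq> 0 \<Longrightarrow>
      sim_equiv (scaleR a (mat_unit i i - mat_unit j j) :: ('h, 'n) sqmat) (off_diag i j z)"
  shows "outer_eq x y \<longleftrightarrow> x = 0 \<or> y = 0 \<or> sim_equiv x y"
proof
  assume eq: "outer_eq x y"
  show "x = 0 \<or> y = 0 \<or> sim_equiv x y"
  proof (cases "x = 0 \<or> y = 0")
    case False
    then have nz: "x \<noteq> 0" "y \<noteq> 0" by simp_all
    obtain i j a z where "i \<noteq> j" "z \<noteq> 0" "x = scaleR a (mat_unit i i - mat_unit j j)" "y = off_diag i j z"
      by (rule outer_eq_diagonal_shape[OF xy eq nz])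
    then show ?thesis using phase by simp
  qed auto
next
  assume "x = 0 \<or> y = 0 \<or> sim_equiv x y"
  then show "outer_eq x y"
    using outer_eq_zero outer_eq_if_sim_equiv_diagonal[OF xy] by blast
qed

lemma commutator_bound_assoc:
  fixes x y :: "('h::assoc_hurwitz, 'n::{finite,linorder}) sqmat"
  assumes xy: "x \<in> Herm" "y \<in> Herm"
  shows "norm_sq (comm x y) \<le> 2 * norm_sq x * norm_sq y"
    and "outer_eq x y \<longleftrightarrow> x = 0 \<or> y = 0 \<or> sim_equiv x y"
proof -
  obtain u where u: "unitary u" "diagonal (conjugate_by u x)"
    using unitary_diagonalisation[OF xy(1)] by blast
  let ?c = "conjugate_by u"
  have H: "?c x \<in> Herm" "?c y \<in> Herm" using xy by (simp_all add: Herm_conjugate_by)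
  have n: "norm_sq (?c z) = norm_sq z" for z using u by (simp add: norm_sq_def frob_conjugate_by)
  have z: "?c z = 0 \<longleftrightarrow> z = 0" for z using n[of z] by (metis norm_sq_eq_0)
  have nc: "norm_sq (comm (?c x) (?c y)) = norm_sq (comm x y)"
    using u by (simp add: comm_conjugate_by n)
  show "norm_sq (comm x y) \<le> 2 * norm_sq x * norm_sq y"
    using norm_sq_comm_le_diagonal[OF H(1) u(2), of "?c y"] by (simp add: n nc)
  have "outer_eq x y \<longleftrightarrow> outer_eq (?c x) (?c y)" by (simp add: outer_eq_def n nc)
  also have "\<dots> \<longleftrightarrow> ?c x = 0 \<or> ?c y = 0 \<or> sim_equiv (?c x) (?c y)"
    by (rule outer_eq_iff_diagonal[OF H u(2)]) (rule sim_equiv_off_diag_assoc)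
  also have "\<dots> \<longleftrightarrow> x = 0 \<or> y = 0 \<or> sim_equiv x y"
    by (simp add: z sim_equiv_jordan_aut[OF jordan_aut_conjugate_by[OF u(1)] xy])
  finally show "outer_eq x y \<longleftrightarrow> x = 0 \<or> y = 0 \<or> sim_equiv x y" .
qed

lemma gram_shift:
  fixes x y :: "('h::hurwitz_algebra, 'n::finite) sqmat"
  defines "gram \<equiv> \<lambda>y. norm_sq x * norm_sq y - (frob x y)\<^sup>2"
  shows "gram (y - scaleR c x) = gram y"
  by (simp add: gram_def norm_sq_def frob_eq_inner inner_diff_left inner_diff_right inner_commute[of y x]
      power2_eq_square algebra_simps)

lemma comm_shift: "comm x (y - scaleR c x) = comm x (y :: ('h::hurwitz_algebra, 'n::finite) sqmat)"
  by (simp add: comm_def mmul.diff_left mmul.diff_right mmul.scaleR_left mmul.scaleR_right)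

text \<open>The matrix \<open>y'\<close> is the component of \<open>y\<close> orthogonal to \<open>x\<close>, for which the two upper bounds
  coincide. Division by zero in its coefficient is harmless since \<open>x = 0\<close> leaves \<open>y' = y\<close>. If
  \<open>sim_equiv x (y - k x)\<close> holds for some other \<open>k\<close>, equality in the weaker bound together with the sharper one
  forces \<open>y - k x\<close> to be orthogonal to \<open>x\<close>.\<close>

lemma sharp_inequality:
  fixes x y :: "('h::hurwitz_algebra, 'n::{finite,linorder}) sqmat"
  assumes xy: "x \<in> Herm" "y \<in> Herm"
    and bound: "\<And>y. y \<in> Herm \<Longrightarrow> norm_sq (comm x y) \<le> 2 * norm_sq x * norm_sq y"
    and outer: "\<And>y. y \<in> Herm \<Longrightarrow> outer_eq x y \<longleftrightarrow> x = 0 \<or> y = 0 \<or> sim_equiv x y"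
  shows "ineq_star x y"
    and "inner_eq x y \<longleftrightarrow> lin_dep_real x y \<or> (\<exists>c. sim_equiv x (y - scaleR c x))"
proof -
  define c where "c = frob x y / norm_sq x"
  define y' where "y' = y - scaleR c x"
  have y': "y' \<in> Herm" by (simp add: y'_def Herm_diff Herm_scaleR xy)
  have nx: "norm_sq x = 0 \<longleftrightarrow> x = 0" by (rule norm_sq_eq_0)
  have orth: "frob x y' = 0"
  proof (cases "x = 0")
    case False
    then show ?thesis using nx
      by (simp add: y'_def c_def frob_eq_inner inner_diff_right norm_sq_def)
  qed (simp add: frob_eq_inner)
  have gram: "norm_sq x * norm_sq y - (frob x y)\<^sup>2 = norm_sq x * norm_sq y'"
    using gram_shift[of x y c] by (simp add: y'_def[symmetric] orth)
  have comm: "norm_sq (comm x y) = norm_sq (comm x y')" by (simp add: y'_def comm_shift)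
  show ineq: "ineq_star x y"
    unfolding ineq_star_def
  proof
    show "norm_sq (comm x y) \<le> 2 * (norm_sq x * norm_sq y - (frob x y)\<^sup>2)"
      unfolding gram comm using bound[OF y'] by simp
  qed simp
  have inner: "inner_eq x y \<longleftrightarrow> outer_eq x y'"
    by (simp add: inner_eq_def outer_eq_def gram comm mult.assoc)
  show "inner_eq x y \<longleftrightarrow> lin_dep_real x y \<or> (\<exists>c. sim_equiv x (y - scaleR c x))"
  proof
    assume "inner_eq x y"
    then consider "x = 0" | "y' = 0" | "sim_equiv x y'" using inner outer[OF y'] by blast
    then show "lin_dep_real x y \<or> (\<exists>c. sim_equiv x (y - scaleR c x))"
    proof cases
      case 1
      then have "scaleR 1 x + scaleR 0 y = 0" by simp
      then show ?thesis unfolding lin_dep_real_def by (metis zero_neq_one)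
    next
      case 2
      then have "scaleR (- c) x + scaleR 1 y = 0" by (simp add: y'_def)
      then show ?thesis unfolding lin_dep_real_def by (metis zero_neq_one)
    qed (auto simp: y'_def)
  next
    assume "lin_dep_real x y \<or> (\<exists>c. sim_equiv x (y - scaleR c x))"
    then show "inner_eq x y"
    proof
      assume "lin_dep_real x y"
      then obtain a b where ab: "a \<noteq> 0 \<or> b \<noteq> 0" and eq: "scaleR a x + scaleR b y = 0"
        by (auto simp: lin_dep_real_def)
      show ?thesis
      proof (cases "b = 0")
        case True
        then have "x = 0" using ab eq by simp
        then show ?thesis unfolding inner outer[OF y'] by blast
      next
        case False
        have "scaleR b y = scaleR b (scaleR (- a / b) x)" using eq False by (simp add: add_eq_0_iff)
        then have "y = scaleR (- a / b) x" using False by (simp only: scaleR_cancel_left) simp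
        then show ?thesis
          by (simp add: inner_eq_def comm_def mmul.scaleR_left mmul.scaleR_right mmul.minus_left mmul.minus_right
              norm_sq_def frob_eq_inner power2_eq_square)
      qed
    next
      assume "\<exists>c. sim_equiv x (y - scaleR c x)"
      then obtain k where k: "sim_equiv x (y - scaleR k x)" by blast
      let ?z = "y - scaleR k x"
      have eq: "outer_eq x ?z" using k by (simp add: outer Herm_diff Herm_scaleR xy)
      have "norm_sq (comm x y) = 2 * norm_sq x * norm_sq ?z"
        using eq by (simp add: outer_eq_def comm_shift)
      moreover have "norm_sq (comm x y) \<le> 2 * (norm_sq x * norm_sq ?z - (frob x ?z)\<^sup>2)"
        using ineq unfolding ineq_star_def gram_shift by simp
      ultimately have "(frob x ?z)\<^sup>2 \<le> 0" by (simp add: algebra_simps)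
      then have "frob x ?z = 0" by simp
      then show ?thesis using eq gram_shift[of x y k] by (simp add: inner_eq_def outer_eq_def comm_shift mult.assoc)
    qed
  qed
qed

lemma lin_dep_if_lin_dep_real: "lin_dep_real x y \<Longrightarrow> lin_dep x (y :: ('h::hurwitz_algebra, 'n::finite) sqmat)"
proof -
  assume "lin_dep_real x y"
  then obtain a b where ab: "a \<noteq> 0 \<or> b \<noteq> 0" and eq: "scaleR a x + scaleR b y = 0"
    by (auto simp: lin_dep_real_def)
  have "scaleR a 1 * x $ i $ j + scaleR b 1 * y $ i $ j = 0" for i j
    using arg_cong[OF eq, of "\<lambda>m. m $ i $ j"] by (simp add: hmult_scaleR_left hmult_one_left)
  moreover have "scaleR a (1::'h) \<noteq> 0 \<or> scaleR b (1::'h) \<noteq> 0" using ab by (simp add: hone_neq_zero)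
  ultimately show ?thesis unfolding lin_dep_def by blast
qed

lemma lin_dep_realI_scaleR: "y = scaleR c x \<Longrightarrow> lin_dep_real x y"
  unfolding lin_dep_real_def by (rule exI[of _ "- c"], rule exI[of _ 1]) simp

lemma lin_dep_realI_zero: "x = 0 \<Longrightarrow> lin_dep_real x y"
  unfolding lin_dep_real_def by (rule exI[of _ 1], rule exI[of _ 0]) simp

lemma lin_dep_left_multiple:
  fixes x y :: "('h::hurwitz_algebra, 'n::finite) sqmat"
  assumes "lin_dep x y" "x \<noteq> 0"
  obtains a b where "b \<noteq> 0" "\<And>i j. b * y $ i $ j = - (a * x $ i $ j)"
proof -
  obtain a b where ab: "a \<noteq> 0 \<or> b \<noteq> 0" "\<And>i j. a * x $ i $ j + b * y $ i $ j = 0"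
    using assms(1) by (auto simp: lin_dep_def)
  have "b \<noteq> 0"
  proof
    assume "b = 0"
    then have "a * x $ i $ j = 0" for i j using ab(2)[of i j] by (simp add: hmult_zero_left)
    then show False using ab(1) \<open>b = 0\<close> assms(2) by (auto simp: mult_eq_0_hurwitz vec_eq_iff)
  qed
  moreover have "b * y $ i $ j = - (a * x $ i $ j)" for i j
    using ab(2)[of i j] by (simp add: add_eq_0_iff)
  ultimately show thesis using that by blast
qed

text \<open>If \<open>y = c x\<close> with both matrices Hermitian, comparing a nonzero entry with the conjugate of its mirror
  image and commuting the factors gives \<open>c = hconj c\<close>.\<close>

lemma lin_dep_iff_real_comm:
  fixes x y :: "('h::comm_hurwitz, 'n::finite) sqmat"
  assumes xy: "x \<in> Herm" "y \<in> Herm"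
  shows "lin_dep x y \<longleftrightarrow> lin_dep_real x y"
proof
  assume dep: "lin_dep x y"
  show "lin_dep_real x y"
  proof (cases "x = 0")
    case False
    obtain a b where b: "b \<noteq> 0" and eq: "\<And>i j. b * y $ i $ j = - (a * x $ i $ j)"
      by (rule lin_dep_left_multiple[OF dep False]) blast
    define c where "c = - scaleR (1 / (norm b)\<^sup>2) (hconj b * a)"
    have y: "y $ i $ j = c * x $ i $ j" for i j
    proof -
      have "scaleR ((norm b)\<^sup>2) (y $ i $ j) = - (hconj b * (a * x $ i $ j))"
        unfolding hconj_mult_cancel[symmetric] eq hmult_minus_right ..
      also have "\<dots> = scaleR ((norm b)\<^sup>2) (c * x $ i $ j)"
        using b by (simp add: c_def hmult_minus_left hmult_scaleR_left hmult_assoc)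
      finally show ?thesis using b by simp
    qed
    obtain i j where "x $ i $ j \<noteq> 0" using False by (auto simp: vec_eq_iff)
    have "c * x $ i $ j = hconj c * x $ i $ j"
      using y[of i j] y[of j i] HermD[OF xy(1), of j i] HermD[OF xy(2), of j i]
      by (metis hconj_mult hmult_commute)
    then have "(hconj c - c) * x $ i $ j = 0" by (simp add: hmult.diff_left)
    then have "hconj c = c" using \<open>x $ i $ j \<noteq> 0\<close> by (simp add: mult_eq_0_hurwitz)
    then have "c = scaleR (hRe c) 1" by (rule hconj_fixed)
    then have "y $ i $ j = scaleR (hRe c) (x $ i $ j)" for i j
      unfolding y by (metis hmult_one_left hmult_scaleR_left)
    then show ?thesis by (intro lin_dep_realI_scaleR[of y "hRe c" x]) (simp add: vec_eq_iff)
  qed (rule lin_dep_realI_zero)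
qed (rule lin_dep_if_lin_dep_real)

text \<open>A nonzero diagonal entry of \<open>x\<close> is real, as is the corresponding entry of \<open>y\<close>, so the two
  coefficients of the dependence are real multiples of one another and the common factor cancels.\<close>

lemma lin_dep_iff_real_diagonal:
  fixes x y :: "('h::hurwitz_algebra, 'n::finite) sqmat"
  assumes xy: "x \<in> Herm" "y \<in> Herm" "diagonal x"
  shows "lin_dep x y \<longleftrightarrow> lin_dep_real x y"
proof
  assume dep: "lin_dep x y"
  show "lin_dep_real x y"
  proof (cases "x = 0")
    case False
    obtain a b where b: "b \<noteq> 0" and eq: "\<And>i j. b * y $ i $ j = - (a * x $ i $ j)"
      by (rule lin_dep_left_multiple[OF dep False]) blast
    obtain d where x: "x = real_diag d" using diagonal_Herm_real_diag xy by blast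
    obtain k where k: "d k \<noteq> 0" using False by (auto simp: x vec_eq_iff real_diag_nth split: if_splits)
    define c where "c = hRe (y $ k $ k) / d k"
    have diag: "scaleR (hRe (y $ i $ i)) b = scaleR (- d i) a" for i
      using eq[of i i] arg_cong[OF Herm_diagonal_entry[OF xy(2), of i], of "(*) b"]
      by (simp add: x real_diag_nth hmult_scaleR_right hmult_one_right)
    have "scaleR (d k) a = scaleR (d k) (scaleR (- c) b)"
      using diag[of k] k by (simp add: c_def)
    then have a: "a = scaleR (- c) b" using k by (metis scaleR_cancel_left)
    have "b * (y $ i $ j - scaleR c (x $ i $ j)) = 0" for i j
      using eq[of i j] by (simp add: a hmult.diff_right hmult_scaleR_right hmult_scaleR_left hmult_minus_left)
    then have "y $ i $ j = scaleR c (x $ i $ j)" for i j using b by (simp add: mult_eq_0_hurwitz)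
    then show ?thesis by (intro lin_dep_realI_scaleR[of y c x]) (simp add: vec_eq_iff)
  qed (rule lin_dep_realI_zero)
qed (rule lin_dep_if_lin_dep_real)

lemma outer_eq_iff_diagonal_3:
  fixes x y :: "('h::hurwitz_algebra, 3) sqmat"
  assumes xy: "x \<in> Herm" "y \<in> Herm" "diagonal x"
  shows "outer_eq x y \<longleftrightarrow> x = 0 \<or> y = 0 \<or> sim_equiv x y"
  by (rule outer_eq_iff_diagonal[OF xy]) (rule sim_equiv_off_diag_3)

theorem lemma7p2:
  shows
    "((\<forall>x\<in>Herm. \<forall>y\<in>Herm. ineq_star x (y :: (real, 'n::{finite,linorder}) sqmat)) \<and>
      (\<forall>x\<in>Herm. \<forall>y\<in>Herm. ineq_star x (y :: (complex, 'n) sqmat)) \<and>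
      (\<forall>x\<in>Herm. \<forall>y\<in>Herm. ineq_star x (y :: (quaternion, 'n) sqmat)))
    \<and>
     (\<forall>x\<in>Herm. \<forall>y\<in>Herm. diagonal x \<longrightarrow> ineq_star x (y :: (octonion, 3) sqmat))
    \<and>
     ((\<forall>x\<in>Herm. \<forall>y\<in>Herm. outer_eq x (y :: (real, 'n) sqmat) \<longleftrightarrow> x = 0 \<or> y = 0 \<or> sim_equiv x y) \<and>
      (\<forall>x\<in>Herm. \<forall>y\<in>Herm. outer_eq x (y :: (complex, 'n) sqmat) \<longleftrightarrow> x = 0 \<or> y = 0 \<or> sim_equiv x y) \<and>
      (\<forall>x\<in>Herm. \<forall>y\<in>Herm. outer_eq x (y :: (quaternion, 'n) sqmat) \<longleftrightarrow> x = 0 \<or> y = 0 \<or> sim_equiv x y) \<and>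
      (\<forall>x\<in>Herm. \<forall>y\<in>Herm. diagonal x \<longrightarrow>
         (outer_eq x (y :: (octonion, 3) sqmat) \<longleftrightarrow> x = 0 \<or> y = 0 \<or> sim_equiv x y)))
    \<and>
     ((\<forall>x\<in>Herm. \<forall>y\<in>Herm. inner_eq x (y :: (real, 'n) sqmat) \<longleftrightarrow>
         lin_dep x y \<or> (\<exists>c. sim_equiv x (y - scaleR c x))) \<and>
      (\<forall>x\<in>Herm. \<forall>y\<in>Herm. inner_eq x (y :: (complex, 'n) sqmat) \<longleftrightarrow>
         lin_dep x y \<or> (\<exists>c. sim_equiv x (y - scaleR c x))) \<and>
      (\<forall>x\<in>Herm. \<forall>y\<in>Herm. inner_eq x (y :: (quaternion, 'n) sqmat) \<longleftrightarrow>
         lin_dep_real x y \<or> (\<exists>c. sim_equiv x (y - scaleR c x))) \<and>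
      (\<forall>x\<in>Herm. \<forall>y\<in>Herm. diagonal x \<longrightarrow> (inner_eq x (y :: (octonion, 3) sqmat) \<longleftrightarrow>
         lin_dep x y \<or> (\<exists>c. sim_equiv x (y - scaleR c x)))))"
proof -
  have "ineq_star x y"
    and "inner_eq x y \<longleftrightarrow> lin_dep x y \<or> (\<exists>c. sim_equiv x (y - scaleR c x))"
    if "x \<in> Herm" "y \<in> Herm" "diagonal x" for x y :: "(octonion, 3) sqmat"
    using sharp_inequality[OF that(1,2) norm_sq_comm_le_diagonal[OF that(1,3)]
        outer_eq_iff_diagonal_3[OF that(1) _ that(3)]]
    by (simp_all add: lin_dep_iff_real_diagonal[OF that])
  then show ?thesis
    by (intro conjI ballI impI)
      (simp_all only: commutator_bound_assoc sharp_inequality outer_eq_iff_diagonal_3 lin_dep_iff_real_comm)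
qed

end
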